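(* The equality $\mathfrak n_{\dim}(\mathcal M)=|M|$ holds for every model $\mathcal M=(M,<)$ of DLO, the theory of dense linear orders without endpoints, where $|M|$ is the cardinality of $M$.
   Context: "Definable" means definable in the structure with parameters; $\mathbb N$ is the set of nonnegative integers. Let $\mathcal M=(M,\ldots)$ be a structure, $\mathrm{Def}_n(\mathcal M)$ the collection of definable subsets of $M^n$, and $\mathrm{Def}(\mathcal M)=\bigcup_{n>0}\mathrm{Def}_n(\mathcal M)$. Let $\Pi:M^n\to M^{n-1}$ be the projection forgetting the last coordinate, and for $X\subseteq M^n$, $x\in\Pi(X)$, put $X_x^{\Pi}=\{y\in M: (x,y)\in X\}$. Convention: $-\infty+i=-\infty$. A *dimension function* on $\mathcal M$ is a function $\dim:\mathrm{Def}(\mathcal M)\to\mathbb N\cup\{-\infty\}$ such that for every $n>0$: (1) $\dim(\emptyset)=-\infty$, $\dim(\{a\})=0$ for each $a\in M$, and $\dim(M)=1$; $(2)_n$ $\dim(X\cup Y)=\max\{\dim X,\dim Y\}$ for $X,Y\in\mathrm{Def}_n(\mathcal M)$; $(3)_n$ $\dim X=\dim X^{\sigma}$ for each $X\in\mathrm{Def}_n(\mathcal M)$ and each permutation $\sigma$ of $\{1,\dots,n\}$, where $X^\sigma=\{(x_{\sigma(1)},\dots,x_{\sigma(n)}):(x_1,\dots,x_n)\in X\}$; $(4)_n$ if $n>1$ and $X\in\mathrm{Def}_n(\mathcal M)$, then for $i=0,1$ the set $X(i)=\{x\in\Pi(X):\dim X_x^{\Pi}=i\}$ belongs to $\mathrm{Def}_{n-1}(\mathcal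 M)$ and $\dim(X\cap\Pi^{-1}(X(i)))=\dim(X(i))+i$. $\mathfrak n_{\dim}(\mathcal M)$ is the cardinality of the set of dimension functions on $\mathcal M$. *)

theory Defs
  imports Main "HOL-Library.Option_ord" "HOL-Combinatorics.Permutations"
begin

unbundle cardinal_syntax

text \<open>
  First-order structures. The universe is the whole of the (nonempty) type \<open>'a\<close>. The symbols of the
  language are the elements of \<open>'f\<close> and \<open>'r\<close> that have an arity; all others are not part
  of it and do not occur in well-formed formulas. (HOL has no empty type, so this is how a language
  without function symbols is expressed.)
\<close>

record ('f, 'r, 'a) fo_structure =
  fun_arity :: "'f \<Rightarrow> nat option"
  rel_arity :: "'r \<Rightarrow> nat option"
  fun_interp :: "'f \<Rightarrow> 'a list \<Rightarrow> 'a"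
  rel_interp :: "'r \<Rightarrow> 'a list \<Rightarrow> bool"

datatype 'f fo_term = Var nat | App 'f "'f fo_term list"

datatype ('f, 'r) formula =
    Eql "'f fo_term" "'f fo_term"
  | Rel 'r "'f fo_term list"
  | Neg "('f, 'r) formula"
  | Conj "('f, 'r) formula" "('f, 'r) formula"
  | Exi nat "('f, 'r) formula"

primrec wf_term :: "('f, 'r, 'a) fo_structure \<Rightarrow> 'f fo_term \<Rightarrow> bool" where
  "wf_term M (Var i) \<longleftrightarrow> True"
| "wf_term M (App f ts) \<longleftrightarrow> fun_arity M f = Some (length ts) \<and> list_all (wf_term M) ts"

primrec wf_formula :: "('f, 'r, 'a) fo_structure \<Rightarrow> ('f, 'r) formula \<Rightarrow> bool" where
  "wf_formula M (Eql s t) \<longleftrightarrow> wf_term M s \<and> wf_term M t"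
| "wf_formula M (Rel R ts) \<longleftrightarrow> rel_arity M R = Some (length ts) \<and> list_all (wf_term M) ts"
| "wf_formula M (Neg \<phi>) \<longleftrightarrow> wf_formula M \<phi>"
| "wf_formula M (Conj \<phi> \<psi>) \<longleftrightarrow> wf_formula M \<phi> \<and> wf_formula M \<psi>"
| "wf_formula M (Exi i \<phi>) \<longleftrightarrow> wf_formula M \<phi>"

primrec val :: "('f, 'r, 'a) fo_structure \<Rightarrow> (nat \<Rightarrow> 'a) \<Rightarrow> 'f fo_term \<Rightarrow> 'a" where
  "val M e (Var i) = e i"
| "val M e (App f ts) = fun_interp M f (map (val M e) ts)"

primrec sat :: "('f, 'r, 'a) fo_structure \<Rightarrow> (nat \<Rightarrow> 'a) \<Rightarrow> ('f, 'r) formula \<Rightarrow> bool" where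
  "sat M e (Eql s t) \<longleftrightarrow> val M e s = val M e t"
| "sat M e (Rel R ts) \<longleftrightarrow> rel_interp M R (map (val M e) ts)"
| "sat M e (Neg \<phi>) \<longleftrightarrow> \<not> sat M e \<phi>"
| "sat M e (Conj \<phi> \<psi>) \<longleftrightarrow> sat M e \<phi> \<and> sat M e \<psi>"
| "sat M e (Exi i \<phi>) \<longleftrightarrow> (\<exists>a. sat M (e(i := a)) \<phi>)"

text \<open>
  The Cartesian power \<open>M\<^sup>n\<close> is the set of lists of length \<open>n\<close>; an element \<open>a\<close> of \<open>M\<close> is the list
  \<open>[a]\<close> in \<open>M\<^sup>1\<close>. Definability is with parameters: the variables \<open>0, \<dots>, n - 1\<close> stand for the
  coordinates, and \<open>e\<close> assigns parameters to all others, of which only finitely many occur in \<open>\<phi>\<close>.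
\<close>

definition definable_sets :: "('f, 'r, 'a) fo_structure \<Rightarrow> nat \<Rightarrow> 'a list set set" where
  "definable_sets M n =
    {X. \<exists>\<phi> e. wf_formula M \<phi> \<and>
         X = {xs. length xs = n \<and> sat M (\<lambda>i. if i < n then xs ! i else e i) \<phi>}}"

definition all_definable_sets :: "('f, 'r, 'a) fo_structure \<Rightarrow> 'a list set set" where
  "all_definable_sets M = (\<Union>n\<in>{0<..}. definable_sets M n)"

definition fibre :: "'a list set \<Rightarrow> 'a list \<Rightarrow> 'a list set" where
  "fibre X x = {[y] | y. x @ [y] \<in> X}"

definition fibre_dim_set :: "('a list set \<Rightarrow> nat option) \<Rightarrow> 'a list set \<Rightarrow> nat \<Rightarrow> 'a list set" where
  "fibre_dim_set d X i = {x \<in> butlast ` X. d (fibre X x) = Some i}"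

text \<open>
  Values in \<open>\<nat> \<union> {-\<infinity>}\<close> are of type \<^typ>\<open>nat option\<close>, with \<^const>\<open>None\<close> as \<open>-\<infinity>\<close>, which is the least
  element in the order of \<^theory>\<open>HOL-Library.Option_ord\<close>; adding \<open>i\<close> is \<^term>\<open>map_option (\<lambda>k. k + i)\<close>.
  A function on the definable sets is represented by a total function that is \<^const>\<open>undefined\<close>
  elsewhere, so that distinct representatives are distinct functions; this matters for counting.
\<close>

definition dimension_function ::
  "('f, 'r, 'a) fo_structure \<Rightarrow> ('a list set \<Rightarrow> nat option) \<Rightarrow> bool" where
  "dimension_function M d \<longleftrightarrow>
    (\<forall>X. X \<notin> all_definable_sets M \<longrightarrow> d X = undefined) \<and>
    (d {} = None \<and> (\<forall>a. d {[a]} = Some 0) \<and> d {[a] | a. True} = Some 1) \<and>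
    (\<forall>n>0.
      (\<forall>X\<in>definable_sets M n. \<forall>Y\<in>definable_sets M n. d (X \<union> Y) = max (d X) (d Y)) \<and>
      (\<forall>X\<in>definable_sets M n. \<forall>\<sigma>. \<sigma> permutes {..<n} \<longrightarrow> d (permute_list \<sigma> ` X) = d X) \<and>
      (n > 1 \<longrightarrow> (\<forall>X\<in>definable_sets M n. \<forall>i\<in>{0, 1}.
         fibre_dim_set d X i \<in> definable_sets M (n - 1) \<and>
         d {xs \<in> X. butlast xs \<in> fibre_dim_set d X i} =
           map_option (\<lambda>k. k + i) (d (fibre_dim_set d X i)))))"

text \<open>A cardinal is, as in the library, a relation up to \<open>=o\<close>.\<close>

definition n_dim :: "('f, 'r, 'a) fo_structure \<Rightarrow> ('a list set \<Rightarrow> nat option) rel" where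
  "n_dim M = |{d. dimension_function M d}|"

definition order_structure :: "(unit, unit, 'a::ord) fo_structure" where
  "order_structure =
    \<lparr>fun_arity = (\<lambda>_. None), rel_arity = (\<lambda>_. Some 2),
     fun_interp = (\<lambda>_ _. undefined), rel_interp = (\<lambda>_ xs. xs ! 0 < xs ! 1)\<rparr>"

end

theory Submission
  imports Defs "HOL-Library.Countable"
begin

text \<open>
  By a back-and-forth argument, a set of tuples is definable iff it is invariant under all
  order-preserving changes of a tuple that respect some finite set of parameters.

  Lower bound: for each \<open>c\<close>, the largest number of coordinates above \<open>c\<close> of a tuple that lie outside
  a finite set, minimised over all finite sets, is a dimension function; it makes the interval
  \<open>(c, c')\<close> one-dimensional, whereas its analogue for \<open>c'\<close> makes it zero-dimensional.

  Upper bound: the fibre axiom reduces a dimension function to subsets of \<open>M\<close>, which are finite unions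
  of points, intervals and rays. All intervals and rays are fibres of one definable family, so the
  dimension function is determined by the definable set of those parameters whose fibre has
  dimension zero, and there are only \<open>|M|\<close> definable sets.
\<close>

section \<open>Finite partial isomorphisms\<close>

text \<open>The order \<open>M\<close> is arbitrary: it may be rigid and need not be saturated, so
  neither automorphisms nor generic tuples are available. Finite partial isomorphisms replace the
  former; discarding finitely many exceptional values replaces the latter.

  In a dense linear order every set is algebraically closed. Declaring all points up to
  \<open>c\<close> algebraic as well gives the closure operator
  \<open>A \<mapsto> A \<union> {..c}\<close>, and \<open>dim_above c\<close> is its rank. Its
  additivity over fibres rests on one fact: a coordinate that differs from all parameters and all
  other coordinates can be moved to infinitely many places, so an infinite fibre is the same as a
  fibre with one new point.

  For the upper bound, the obstacle is that free choices of zero-dimensional intervals could number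
  as many as 2^|M|. The definability clause of the fibre axiom removes this freedom, but it speaks
  of one definable set at a time; hence the effort to fit intervals and rays into a single
  family.\<close>

definition order_preserving :: "('a::linorder \<times> 'a) set \<Rightarrow> bool" where
  "order_preserving R \<longleftrightarrow> (\<forall>x y x' y'. (x, y) \<in> R \<longrightarrow> (x', y') \<in> R \<longrightarrow> (x < x' \<longleftrightarrow> y < y'))"

lemma order_preservingD:
  "order_preserving R \<Longrightarrow> (x, y) \<in> R \<Longrightarrow> (x', y') \<in> R \<Longrightarrow> x < x' \<longleftrightarrow> y < y'"
  unfolding order_preserving_def by blast

text \<open>Trichotomy turns the comparison of strict orders into one of equalities, so the relation
  is the graph of an injective partial map. Relations are handier than maps here: matched tuples
  with repeated entries and the identity on parameters are simply united.\<close>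

lemma order_preserving_eqD:
  "order_preserving R \<Longrightarrow> (x, y) \<in> R \<Longrightarrow> (x', y') \<in> R \<Longrightarrow> x = x' \<longleftrightarrow> y = y'"
  by (metis order_preservingD linorder_neq_iff)

lemma order_preserving_mono: "order_preserving R \<Longrightarrow> S \<subseteq> R \<Longrightarrow> order_preserving S"
  unfolding order_preserving_def by blast

lemma order_preserving_Id: "order_preserving (Id_on A)"
  unfolding order_preserving_def by auto

lemma order_preserving_converse: "order_preserving (R\<inverse>) \<longleftrightarrow> order_preserving R"
  unfolding order_preserving_def by auto

lemma set_zip_converse: "(set (zip xs ys))\<inverse> = set (zip ys xs)"
  by (auto simp: set_zip)

text \<open>The image of a new point has only to lie between the images of finitely many lower and
  finitely many upper points, which leaves room for a whole open interval. Existence is enough for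
  back-and-forth; infinitude is what separates dimension one from dimension zero in
  \<open>infinite_fibre_above_iff\<close>.\<close>

lemma infinite_extensions:
  fixes R :: "('a::unbounded_dense_linorder \<times> 'a) set"
  assumes R: "finite R" "order_preserving R" and a: "a \<notin> Domain R"
  shows "infinite {b. order_preserving (insert (a, b) R)}"
proof -
  define L U where "L = {y. \<exists>x. (x, y) \<in> R \<and> x < a}" and "U = {y. \<exists>x. (x, y) \<in> R \<and> a < x}"
  have "L \<subseteq> snd ` R" "U \<subseteq> snd ` R" unfolding L_def U_def by force+
  hence fin: "finite L" "finite U" using R(1) by (auto intro: finite_subset)
  have LU: "l < u" if "l \<in> L" "u \<in> U" for l u
  proof -
    from that obtain x x' where "(x, l) \<in> R" "x < a" "(x', u) \<in> R" "a < x'"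
      unfolding L_def U_def by blast
    with order_preservingD[OF R(2)] show ?thesis using less_trans by blast
  qed
  \<comment> \<open>The upper end is fixed first and the lower end below it, so that an empty
    \<open>U\<close> or \<open>L\<close> is replaced by any point beyond what is already
    there.\<close>
  have "\<exists>u0. (\<forall>u\<in>U. u0 \<le> u) \<and> (\<forall>l\<in>L. l < u0)"
  proof (cases "U = {}")
    case True
    obtain t where t: "L \<noteq> {} \<Longrightarrow> Max L < t" using gt_ex by blast
    have "\<forall>l\<in>L. l < t" using t Max_less_iff[OF fin(1)] by blast
    with True show ?thesis by blast
  next
    case False
    with fin LU show ?thesis by (intro exI[of _ "Min U"]) simp
  qed
  then obtain u0 where u0: "\<forall>u\<in>U. u0 \<le> u" "\<forall>l\<in>L. l < u0" by blast
  have "\<exists>l0. (\<forall>l\<in>L. l \<le> l0) \<and> l0 < u0"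
  proof (cases "L = {}")
    case True
    then show ?thesis using lt_ex by blast
  next
    case False
    with fin u0 show ?thesis by (intro exI[of _ "Max L"]) simp
  qed
  then obtain l0 where l0: "\<forall>l\<in>L. l \<le> l0" "l0 < u0" by blast
  have "{l0<..<u0} \<subseteq> {b. order_preserving (insert (a, b) R)}"
  proof
    fix b assume b: "b \<in> {l0<..<u0}"
    have *: "(x < a \<longleftrightarrow> y < b) \<and> (a < x \<longleftrightarrow> b < y)" if xy: "(x, y) \<in> R" for x y
    proof (cases "x < a")
      case True
      hence "y \<in> L" using xy unfolding L_def by blast
      with b l0 have "y < b" by force
      with True show ?thesis by auto
    next
      case False
      hence "a < x" using xy a by (metis Domain.DomainI linorder_neqE)
      hence "y \<in> U" using xy unfolding U_def by blast
      with b u0 have "b < y" by force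
      with \<open>a < x\<close> show ?thesis by auto
    qed
    show "b \<in> {b. order_preserving (insert (a, b) R)}"
      unfolding order_preserving_def mem_Collect_eq
    proof (intro allI impI)
      fix x y x' y' assume "(x, y) \<in> insert (a, b) R" "(x', y') \<in> insert (a, b) R"
      then show "x < x' \<longleftrightarrow> y < y'"
        using *[of x y] *[of x' y'] order_preservingD[OF R(2), of x y x' y'] by auto
    qed
  qed
  moreover have "infinite {l0<..<u0}" using l0 by simp
  ultimately show ?thesis using finite_subset by blast
qed

lemma order_preserving_extend:
  fixes R :: "('a::unbounded_dense_linorder \<times> 'a) set"
  assumes "finite R" "order_preserving R"
  obtains b where "order_preserving (insert (a, b) R)"
proof (cases "a \<in> Domain R")
  case True
  then obtain b where "(a, b) \<in> R" by blast
  hence "insert (a, b) R = R" by blast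
  with assms that show ?thesis by metis
next
  case False
  with infinite_extensions[OF assms] that show ?thesis
    using not_finite_existsD by blast
qed

section \<open>Definable sets are the finitely supported ones\<close>

abbreviation DLO :: "(unit, unit, 'a::unbounded_dense_linorder) fo_structure" where
  "DLO \<equiv> order_structure"

lemma wf_term_DLO: "wf_term DLO t \<longleftrightarrow> (\<exists>i. t = Var i)"
  by (cases t) (auto simp: order_structure_def)

text \<open>Quantifier elimination in the form of a back-and-forth argument.\<close>

lemma sat_order_invariant:
  assumes "wf_formula (DLO :: (unit, unit, 'a::unbounded_dense_linorder) fo_structure) \<phi>"
  obtains V where "finite V"
    "\<And>e e' :: nat \<Rightarrow> 'a.
       order_preserving ((\<lambda>i. (e i, e' i)) ` V) \<Longrightarrow> sat DLO e \<phi> \<longleftrightarrow> sat DLO e' \<phi>"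
proof -
  have "\<exists>V. finite V \<and> (\<forall>e e' :: nat \<Rightarrow> 'a. order_preserving ((\<lambda>i. (e i, e' i)) ` V) \<longrightarrow>
    (sat DLO e \<phi> \<longleftrightarrow> sat DLO e' \<phi>))"
    using assms
  proof (induction \<phi>)
    case (Eql s t)
    then obtain i j where ij: "s = Var i" "t = Var j" by (auto simp: wf_term_DLO)
    show ?case
    proof (intro exI[of _ "{i, j}"] conjI allI impI)
      fix e e' :: "nat \<Rightarrow> 'a"
      assume "order_preserving ((\<lambda>i. (e i, e' i)) ` {i, j})"
      from order_preserving_eqD[OF this, of "e i" "e' i" "e j" "e' j"]
      show "sat DLO e (Eql s t) \<longleftrightarrow> sat DLO e' (Eql s t)"
        by (simp add: ij order_structure_def)
    qed simp
  next
    case (Rel r ts)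
    then have len: "length ts = 2" and wf: "list_all (wf_term (DLO :: (unit, unit, 'a) fo_structure)) ts"
      by (simp_all add: order_structure_def)
    obtain s t where "ts = [s, t]"
      using len by (auto simp: numeral_2_eq_2 length_Suc_conv)
    with wf obtain i j where ij: "ts = [Var i, Var j]" by (auto simp: wf_term_DLO)
    show ?case
    proof (intro exI[of _ "{i, j}"] conjI allI impI)
      fix e e' :: "nat \<Rightarrow> 'a"
      assume "order_preserving ((\<lambda>i. (e i, e' i)) ` {i, j})"
      from order_preservingD[OF this, of "e i" "e' i" "e j" "e' j"]
      show "sat DLO e (Rel r ts) \<longleftrightarrow> sat DLO e' (Rel r ts)"
        by (simp add: ij order_structure_def)
    qed simp
  next
    case (Neg \<phi>)
    then show ?case by auto
  next
    case (Conj \<phi> \<psi>)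
    then obtain V W where VW: "finite V" "finite W"
      "\<And>e e' :: nat \<Rightarrow> 'a. order_preserving ((\<lambda>i. (e i, e' i)) ` V) \<Longrightarrow> sat DLO e \<phi> \<longleftrightarrow> sat DLO e' \<phi>"
      "\<And>e e' :: nat \<Rightarrow> 'a. order_preserving ((\<lambda>i. (e i, e' i)) ` W) \<Longrightarrow> sat DLO e \<psi> \<longleftrightarrow> sat DLO e' \<psi>"
      by auto
    show ?case
    proof (intro exI[of _ "V \<union> W"] conjI allI impI)
      fix e e' :: "nat \<Rightarrow> 'a"
      assume *: "order_preserving ((\<lambda>i. (e i, e' i)) ` (V \<union> W))"
      have "order_preserving ((\<lambda>i. (e i, e' i)) ` V)" "order_preserving ((\<lambda>i. (e i, e' i)) ` W)"
        by (auto intro: order_preserving_mono[OF *])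
      with VW(3,4) show "sat DLO e (Conj \<phi> \<psi>) \<longleftrightarrow> sat DLO e' (Conj \<phi> \<psi>)" by simp
    qed (use VW in auto)
  next
    case (Exi k \<phi>)
    then obtain V where V: "finite V"
      "\<And>e e' :: nat \<Rightarrow> 'a. order_preserving ((\<lambda>i. (e i, e' i)) ` V) \<Longrightarrow> sat DLO e \<phi> \<longleftrightarrow> sat DLO e' \<phi>"
      by auto
    have half: "sat DLO e' (Exi k \<phi>)"
      if op: "order_preserving ((\<lambda>i. (e i, e' i)) ` V)" and "sat DLO e (Exi k \<phi>)"
      for e e' :: "nat \<Rightarrow> 'a"
    proof -
      from that obtain a where a: "sat DLO (e(k := a)) \<phi>" by auto
      obtain b where b: "order_preserving (insert (a, b) ((\<lambda>i. (e i, e' i)) ` V))"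
        using order_preserving_extend[OF _ op] V(1) by blast
      have "order_preserving ((\<lambda>i. ((e(k := a)) i, (e'(k := b)) i)) ` V)"
        by (rule order_preserving_mono[OF b]) auto
      from V(2)[OF this] a have "sat DLO (e'(k := b)) \<phi>" by blast
      then show ?thesis unfolding sat.simps by blast
    qed
    \<comment> \<open>The reverse implication is \<open>half\<close> for the inverse partial
      isomorphism; this is the back step.\<close>
    have conv: "order_preserving ((\<lambda>i. (e' i, e i)) ` V)"
      if "order_preserving ((\<lambda>i. (e i, e' i)) ` V)" for e e' :: "nat \<Rightarrow> 'a"
    proof -
      have "((\<lambda>i. (e i, e' i)) ` V)\<inverse> = (\<lambda>i. (e' i, e i)) ` V" by auto
      with that show ?thesis using order_preserving_converse by metis
    qed
    show ?case
      using V(1) half conv by (intro exI[of _ V]) blast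
  qed
  with that show ?thesis by blast
qed

text \<open>A finite \<open>A\<close> splits \<open>M^n\<close> into finitely many order types over
  \<open>A\<close>, and a set with support \<open>A\<close> is a union of these classes. One
  direction of preservation is enough, because inverting the relation gives the other.\<close>

definition supports :: "'a::linorder set \<Rightarrow> nat \<Rightarrow> 'a list set \<Rightarrow> bool" where
  "supports A n X \<longleftrightarrow> (\<forall>xs ys. length xs = n \<longrightarrow> length ys = n \<longrightarrow> xs \<in> X \<longrightarrow>
     order_preserving (set (zip xs ys) \<union> Id_on A) \<longrightarrow> ys \<in> X)"

lemma supportsI:
  assumes "\<And>xs ys. length xs = n \<Longrightarrow> length ys = n \<Longrightarrow> xs \<in> X \<Longrightarrow>
     order_preserving (set (zip xs ys) \<union> Id_on A) \<Longrightarrow> ys \<in> X"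
  shows "supports A n X"
  using assms unfolding supports_def by blast

lemma supportsD:
  assumes "supports A n X" "xs \<in> X" "length xs = n" "length ys = n"
    "order_preserving (set (zip xs ys) \<union> Id_on A)"
  shows "ys \<in> X"
  using assms unfolding supports_def by blast

lemma supportsD_iff:
  assumes "supports A n X" "length xs = n" "length ys = n"
    and op: "order_preserving (set (zip xs ys) \<union> Id_on A)"
  shows "xs \<in> X \<longleftrightarrow> ys \<in> X"
proof -
  have "(set (zip xs ys) \<union> Id_on A)\<inverse> = set (zip ys xs) \<union> Id_on A"
    by (simp add: converse_Un set_zip_converse)
  with op have "order_preserving (set (zip ys xs) \<union> Id_on A)"
    using order_preserving_converse by metis
  with assms show ?thesis using supportsD by metis
qed

lemma supports_mono: "supports A n X \<Longrightarrow> A \<subseteq> B \<Longrightarrow> supports B n X"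
  unfolding supports_def by (blast intro: order_preserving_mono)

lemma ex_formula_finite_disj:
  assumes "finite S" "\<And>s. s \<in> S \<Longrightarrow> \<exists>\<phi>. wf_formula M \<phi> \<and> (\<forall>e. sat M e \<phi> \<longleftrightarrow> P s e)"
  shows "\<exists>\<phi>. wf_formula M \<phi> \<and> (\<forall>e. sat M e \<phi> \<longleftrightarrow> (\<exists>s\<in>S. P s e))"
  using assms
proof (induction S rule: finite_induct)
  case empty
  show ?case by (intro exI[of _ "Neg (Eql (Var 0) (Var 0))"]) simp
next
  case (insert s S)
  then obtain \<phi> \<psi> where "wf_formula M \<phi>" "\<forall>e. sat M e \<phi> \<longleftrightarrow> P s e"
    "wf_formula M \<psi>" "\<forall>e. sat M e \<psi> \<longleftrightarrow> (\<exists>s\<in>S. P s e)" by blast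
  then show ?case by (intro exI[of _ "Neg (Conj (Neg \<phi>) (Neg \<psi>))"]) auto
qed

lemma ex_formula_finite_conj:
  assumes "finite S" "\<And>s. s \<in> S \<Longrightarrow> \<exists>\<phi>. wf_formula M \<phi> \<and> (\<forall>e. sat M e \<phi> \<longleftrightarrow> P s e)"
  shows "\<exists>\<phi>. wf_formula M \<phi> \<and> (\<forall>e. sat M e \<phi> \<longleftrightarrow> (\<forall>s\<in>S. P s e))"
proof -
  have "\<exists>\<phi>. wf_formula M \<phi> \<and> (\<forall>e. sat M e \<phi> \<longleftrightarrow> (\<exists>s\<in>S. \<not> P s e))"
  proof (rule ex_formula_finite_disj[OF assms(1)])
    fix s assume "s \<in> S"
    with assms(2) obtain \<phi> where "wf_formula M \<phi>" "\<forall>e. sat M e \<phi> \<longleftrightarrow> P s e" by blast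
    then show "\<exists>\<phi>. wf_formula M \<phi> \<and> (\<forall>e. sat M e \<phi> \<longleftrightarrow> \<not> P s e)"
      by (intro exI[of _ "Neg \<phi>"]) simp
  qed
  then obtain \<phi> where "wf_formula M \<phi>" "\<forall>e. sat M e \<phi> \<longleftrightarrow> (\<exists>s\<in>S. \<not> P s e)" by blast
  then show ?thesis by (intro exI[of _ "Neg \<phi>"]) simp
qed

lemma definable_imp_supported:
  assumes "X \<in> definable_sets (DLO :: (unit, unit, 'a::unbounded_dense_linorder) fo_structure) n"
  obtains A where "finite A" "supports A n X"
proof -
  from assms obtain \<phi> and e :: "nat \<Rightarrow> 'a" where \<phi>: "wf_formula (DLO :: (unit, unit, 'a) fo_structure) \<phi>"
    and X: "X = {xs. length xs = n \<and> sat DLO (\<lambda>i. if i < n then xs ! i else e i) \<phi>}"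
    unfolding definable_sets_def by blast
  obtain V where V: "finite V"
    "\<And>e e' :: nat \<Rightarrow> 'a. order_preserving ((\<lambda>i. (e i, e' i)) ` V) \<Longrightarrow> sat DLO e \<phi> \<longleftrightarrow> sat DLO e' \<phi>"
    using sat_order_invariant[OF \<phi>] by metis
  \<comment> \<open>Truth depends only on the variables in \<open>V\<close>, so their values under
    \<open>e\<close> contain all parameters that matter.\<close>
  have "supports (e ` V) n X"
  proof (rule supportsI)
    fix xs ys assume *: "length xs = n" "length ys = n" "xs \<in> X"
      "order_preserving (set (zip xs ys) \<union> Id_on (e ` V))"
    have "order_preserving ((\<lambda>i. (if i < n then xs ! i else e i, if i < n then ys ! i else e i)) ` V)"
    proof (rule order_preserving_mono[OF *(4)], rule image_subsetI)
      fix i assume "i \<in> V"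
      show "(if i < n then xs ! i else e i, if i < n then ys ! i else e i)
          \<in> set (zip xs ys) \<union> Id_on (e ` V)"
      proof (cases "i < n")
        case True
        with * have "(xs ! i, ys ! i) \<in> set (zip xs ys)" by (auto simp: set_zip)
        with True show ?thesis by simp
      qed (use \<open>i \<in> V\<close> in auto)
    qed
    from V(2)[OF this] * show "ys \<in> X" unfolding X by auto
  qed
  with V(1) that show ?thesis by blast
qed

text \<open>Each order type over finitely many parameters is described by a finite conjunction of
  comparisons and their negations; the formula for \<open>X\<close> is the disjunction of the types
  realised in \<open>X\<close>.\<close>

lemma supported_imp_definable:
  assumes A: "finite A" and X: "supports A n X" "X \<subseteq> {xs. length xs = n}"
  shows "X \<in> definable_sets (DLO :: (unit, unit, 'a::unbounded_dense_linorder) fo_structure) n"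
proof -
  obtain as where as: "set as = A" using finite_list[OF A] by blast
  define N where "N = {..<n + length as}"
  \<comment> \<open>Parameters occupy the variables directly after the coordinates. The type
    \<open>T\<close> below stores strict comparisons only, equality being the absence of
    both.\<close>
  define env where "env xs i = (if i < n then xs ! i else as ! (i - n))" for xs i
  define T where "T e = {(i, j). i \<in> N \<and> j \<in> N \<and> e i < (e j :: 'a)}" for e
  have "T ` env ` X \<subseteq> Pow (N \<times> N)" unfolding T_def by auto
  hence fin: "finite (T ` env ` X)" by (rule finite_subset) (simp add: N_def)
  let ?M = "DLO :: (unit, unit, 'a) fo_structure"
  have ex: "\<exists>\<phi>. wf_formula ?M \<phi> \<and> (\<forall>e. sat DLO e \<phi> \<longleftrightarrow> T e = t)"
    if "t \<in> T ` env ` X" for t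
  proof -
    have t: "t \<subseteq> N \<times> N" using that unfolding T_def by auto
    have "\<exists>\<phi>. wf_formula ?M \<phi> \<and> (\<forall>e. sat DLO e \<phi> \<longleftrightarrow>
        (\<forall>p\<in>N \<times> N. (e (fst p) < (e (snd p) :: 'a)) = (p \<in> t)))"
    proof (rule ex_formula_finite_conj)
      fix p :: "nat \<times> nat"
      let ?\<psi> = "Rel () [Var (fst p), Var (snd p)]"
      show "\<exists>\<phi>. wf_formula ?M \<phi> \<and> (\<forall>e. sat DLO e \<phi> \<longleftrightarrow> (e (fst p) < (e (snd p) :: 'a)) = (p \<in> t))"
        by (rule exI[of _ "if p \<in> t then ?\<psi> else Neg ?\<psi>"]) (simp add: order_structure_def)
    qed (simp add: N_def)
    moreover have "(\<forall>p\<in>N \<times> N. (e (fst p) < (e (snd p) :: 'a)) = (p \<in> t)) \<longleftrightarrow> T e = t" for e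
      using t unfolding T_def by auto
    ultimately show ?thesis by simp
  qed
  obtain \<phi> where \<phi>: "wf_formula ?M \<phi>"
    "\<And>e :: nat \<Rightarrow> 'a. sat DLO e \<phi> \<longleftrightarrow> (\<exists>t\<in>T ` env ` X. T e = t)"
    using ex_formula_finite_disj[where P = "\<lambda>t e. T e = t", OF fin ex] by blast
  have "X = {xs. length xs = n \<and> sat DLO (env xs) \<phi>}"
  proof (intro set_eqI iffI)
    fix ys assume "ys \<in> {xs. length xs = n \<and> sat DLO (env xs) \<phi>}"
    then obtain xs where xs: "xs \<in> X" "T (env ys) = T (env xs)" "length ys = n" using \<phi>(2) by auto
    with X have len: "length xs = n" by auto
    have "order_preserving ((\<lambda>i. (env xs i, env ys i)) ` N)"
      using xs(2) unfolding order_preserving_def T_def set_eq_iff by auto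
    moreover have "set (zip xs ys) \<union> Id_on A \<subseteq> (\<lambda>i. (env xs i, env ys i)) ` N"
    proof -
      have "(xs ! i, ys ! i) \<in> (\<lambda>i. (env xs i, env ys i)) ` N" if "i < n" for i
        using that by (intro image_eqI[of _ _ i]) (auto simp: env_def N_def)
      moreover have "(as ! i, as ! i) \<in> (\<lambda>i. (env xs i, env ys i)) ` N" if "i < length as" for i
        using that by (intro image_eqI[of _ _ "n + i"]) (auto simp: env_def N_def)
      ultimately show ?thesis using len xs(3) by (auto simp: set_zip as[symmetric] in_set_conv_nth)
    qed
    ultimately have "order_preserving (set (zip xs ys) \<union> Id_on A)"
      by (rule order_preserving_mono)
    from supportsD[OF X(1) xs(1) len xs(3) this] show "ys \<in> X" .
  qed (use X(2) \<phi>(2) in auto)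
  then show ?thesis unfolding definable_sets_def env_def using \<phi>(1)
    by (auto intro!: exI[of _ \<phi>] exI[of _ "\<lambda>i. as ! (i - n)"])
qed

section \<open>Closure properties of definable sets\<close>

lemma definable_length: "X \<in> definable_sets M n \<Longrightarrow> xs \<in> X \<Longrightarrow> length xs = n"
  unfolding definable_sets_def by auto

lemma definable_imp_all_definable:
  "X \<in> definable_sets M n \<Longrightarrow> n > 0 \<Longrightarrow> X \<in> all_definable_sets M"
  unfolding all_definable_sets_def by blast

text \<open>A larger set is still a support, so two sets can be treated over the same parameters,
  and closure properties are read off invariance without writing formulas.\<close>

lemma definable_common_support:
  assumes "X \<in> definable_sets DLO n" "Y \<in> definable_sets DLO m"
  obtains A where "finite A" "supports A n X" "supports A m Y"
proof -
  obtain A B where "finite A" "supports A n X" "finite B" "supports B m Y"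
    using assms definable_imp_supported by metis
  then show ?thesis
    using that[of "A \<union> B"] supports_mono[of A n X "A \<union> B"] supports_mono[of B m Y "A \<union> B"] by simp
qed

lemma definable_Un:
  assumes "X \<in> definable_sets DLO n" "Y \<in> definable_sets DLO n"
  shows "X \<union> Y \<in> definable_sets DLO n"
proof -
  obtain A where A: "finite A" "supports A n X" "supports A n Y"
    using definable_common_support[OF assms] by metis
  have "supports A n (X \<union> Y)" using A(2,3) unfolding supports_def by blast
  with A(1) show ?thesis
    by (rule supported_imp_definable) (use assms definable_length in blast)
qed

lemma definable_Diff:
  assumes "X \<in> definable_sets DLO n" "Y \<in> definable_sets DLO n"
  shows "X - Y \<in> definable_sets DLO n"
proof -
  obtain A where A: "finite A" "supports A n X" "supports A n Y"
    using definable_common_support[OF assms] by metis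
  have "supports A n (X - Y)"
  proof (rule supportsI)
    fix xs ys assume *: "length xs = n" "length ys = n" "xs \<in> X - Y"
      "order_preserving (set (zip xs ys) \<union> Id_on A)"
    with A(2,3)[THEN supportsD_iff, OF *(1,2,4)] show "ys \<in> X - Y" by blast
  qed
  with A(1) show ?thesis
    by (rule supported_imp_definable) (use assms definable_length in blast)
qed

lemma definable_empty: "{} \<in> definable_sets DLO n"
  by (rule supported_imp_definable[of "{}"]) (auto simp: supports_def)

lemma definable_singleton: "{[a]} \<in> definable_sets DLO 1"
proof (rule supported_imp_definable[of "{a}"])
  show "supports {a} 1 {[a]}"
  proof (rule supportsI)
    fix xs ys assume *: "length xs = 1" "length ys = 1" "xs \<in> {[a]}"
      "order_preserving (set (zip xs ys) \<union> Id_on {a})"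
    then obtain y where "ys = [y]" by (auto simp: length_Suc_conv)
    with * order_preserving_eqD[OF *(4), of a y a a] show "ys \<in> {[a]}" by auto
  qed
qed auto

lemma definable_permute:
  assumes X: "X \<in> definable_sets DLO n" and \<sigma>: "\<sigma> permutes {..<n}"
  shows "permute_list \<sigma> ` X \<in> definable_sets DLO n"
proof -
  obtain A where A: "finite A" "supports A n X" using definable_imp_supported[OF X] .
  have "supports A n (permute_list \<sigma> ` X)"
  proof (rule supportsI)
    fix xs ys assume *: "length xs = n" "length ys = n" "xs \<in> permute_list \<sigma> ` X"
      "order_preserving (set (zip xs ys) \<union> Id_on A)"
    then obtain zs where zs: "zs \<in> X" "xs = permute_list \<sigma> zs" by blast
    have len: "length zs = n" using zs X definable_length by blast
    define ws where "ws = permute_list (inv \<sigma>) ys"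
    have \<sigma>': "inv \<sigma> permutes {..<n}" using permutes_inv[OF \<sigma>] .
    have ys: "ys = permute_list \<sigma> ws"
      using permute_list_compose[of \<sigma> ys "inv \<sigma>"] \<sigma> * permutes_inv_o[OF \<sigma>] unfolding ws_def
      by (metis permute_list_id)
    have lenw: "length ws = n" using * by (simp add: ws_def)
    \<comment> \<open>Permuting both tuples alike only permutes the matched pairs, so the partial
      isomorphism is the same.\<close>
    have "zip xs ys = permute_list \<sigma> (zip zs ws)"
      using permute_list_zip[OF \<sigma>, of zs ws] zs ys len lenw by simp
    hence "set (zip xs ys) = set (zip zs ws)"
      using \<sigma> len lenw by simp
    with * supportsD[OF A(2) zs(1) len lenw] have "ws \<in> X" by simp
    with ys show "ys \<in> permute_list \<sigma> ` X" by blast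
  qed
  with A(1) show ?thesis
    by (rule supported_imp_definable) (use X definable_length in auto)
qed

text \<open>Projection is existential quantification, and its invariance is one forth step: the
  discarded coordinate of a witness is carried along.\<close>

lemma definable_butlast:
  assumes X: "X \<in> definable_sets DLO (Suc n)"
  shows "butlast ` X \<in> definable_sets DLO n"
proof -
  obtain A where A: "finite A" "supports A (Suc n) X" using definable_imp_supported[OF X] .
  have "supports A n (butlast ` X)"
  proof (rule supportsI)
    fix xs ys assume *: "length xs = n" "length ys = n" "xs \<in> butlast ` X"
      "order_preserving (set (zip xs ys) \<union> Id_on A)"
    then obtain zs where zs: "zs \<in> X" "xs = butlast zs" by blast
    moreover from zs X have "zs \<noteq> []" using definable_length by fastforce
    ultimately obtain a where a: "xs @ [a] \<in> X" by (metis append_butlast_last_id)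
    obtain b where "order_preserving (insert (a, b) (set (zip xs ys) \<union> Id_on A))"
      using order_preserving_extend[OF _ *(4)] A(1) by (auto simp: Id_on_def)
    with * supportsD[OF A(2) a, of "ys @ [b]"] have "ys @ [b] \<in> X" by simp
    then show "ys \<in> butlast ` X" by force
  qed
  with A(1) show ?thesis
    by (rule supported_imp_definable) (use X definable_length in force)
qed

lemma definable_restrict_butlast:
  assumes X: "X \<in> definable_sets DLO (Suc n)" and B: "B \<in> definable_sets DLO n"
  shows "{xs \<in> X. butlast xs \<in> B} \<in> definable_sets DLO (Suc n)"
proof -
  obtain A where A: "finite A" "supports A (Suc n) X" "supports A n B"
    using definable_common_support[OF X B] .
  have "supports A (Suc n) {xs \<in> X. butlast xs \<in> B}"
  proof (rule supportsI)
    fix xs ys assume *: "length xs = Suc n" "length ys = Suc n" "xs \<in> {xs \<in> X. butlast xs \<in> B}"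
      "order_preserving (set (zip xs ys) \<union> Id_on A)"
    from *(1,2) obtain x a y b where eq: "xs = x @ [a]" "ys = y @ [b]" "length x = n" "length y = n"
      by (metis length_Suc_conv_rev)
    from * eq have "order_preserving (set (zip x y) \<union> Id_on A)"
      by (auto intro: order_preserving_mono)
    with supportsD[OF A(3), of x y] supportsD[OF A(2) _ *(1,2,4)] * eq
    show "ys \<in> {xs \<in> X. butlast xs \<in> B}" by simp
  qed
  with A(1) show ?thesis
    by (rule supported_imp_definable) (use X definable_length in auto)
qed

text \<open>The base tuple is absorbed into the support: once its entries are fixed,
  \<open>x\<close> is matched with itself.\<close>

lemma definable_fibre:
  assumes X: "X \<in> definable_sets DLO (Suc n)" and x: "length x = n"
  shows "fibre X x \<in> definable_sets DLO 1"
proof -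
  obtain A where A: "finite A" "supports A (Suc n) X" using definable_imp_supported[OF X] .
  have "supports (A \<union> set x) 1 (fibre X x)"
  proof (rule supportsI)
    fix xs ys assume *: "length xs = 1" "length ys = 1" "xs \<in> fibre X x"
      "order_preserving (set (zip xs ys) \<union> Id_on (A \<union> set x))"
    then obtain a b where ab: "xs = [a]" "ys = [b]" "x @ [a] \<in> X"
      by (auto simp: fibre_def length_Suc_conv)
    have "order_preserving (set (zip (x @ [a]) (x @ [b])) \<union> Id_on A)"
      by (rule order_preserving_mono[OF *(4)]) (auto simp: ab zip_same)
    with supportsD[OF A(2) ab(3), of "x @ [b]"] x have "x @ [b] \<in> X" by simp
    with ab show "ys \<in> fibre X x" by (simp add: fibre_def)
  qed
  then show ?thesis
    by (rule supported_imp_definable[rotated]) (use A(1) in \<open>auto simp: fibre_def\<close>)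
qed

section \<open>The dimension function counting coordinates above a point\<close>

text \<open>Counting in \<open>set xs\<close> makes repeated entries free and invariance under
  permutations immediate. The exceptional set \<open>A\<close> has to serve all tuples of
  \<open>X\<close> at once.\<close>

definition coords_above_le :: "'a::linorder \<Rightarrow> 'a list set \<Rightarrow> nat \<Rightarrow> bool" where
  "coords_above_le c X k \<longleftrightarrow> (\<exists>A. finite A \<and> (\<forall>xs\<in>X. card ({x \<in> set xs. c < x} - A) \<le> k))"

definition dim_above :: "'a::unbounded_dense_linorder \<Rightarrow> 'a list set \<Rightarrow> nat option" where
  "dim_above c X =
    (if X \<in> all_definable_sets DLO
     then if X = {} then None else Some (LEAST k. coords_above_le c X k)
     else undefined)"

lemma coords_above_leI:
  "finite A \<Longrightarrow> (\<And>xs. xs \<in> X \<Longrightarrow> card ({x \<in> set xs. c < x} - A) \<le> k) \<Longrightarrow> coords_above_le c X k"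
  unfolding coords_above_le_def by blast

lemma coords_above_leE:
  assumes "coords_above_le c X k"
  obtains A where "finite A" "\<And>xs. xs \<in> X \<Longrightarrow> card ({x \<in> set xs. c < x} - A) \<le> k"
  using assms unfolding coords_above_le_def by blast

lemma coords_above_le_mono: "coords_above_le c X j \<Longrightarrow> j \<le> k \<Longrightarrow> coords_above_le c X k"
  unfolding coords_above_le_def by (meson order_trans)

lemma coords_above_le_Un:
  "coords_above_le c (X \<union> Y) k \<longleftrightarrow> coords_above_le c X k \<and> coords_above_le c Y k"
proof
  assume *: "coords_above_le c X k \<and> coords_above_le c Y k"
  then obtain A where A: "finite A" "\<forall>xs\<in>X. card ({x \<in> set xs. c < x} - A) \<le> k"
    unfolding coords_above_le_def by blast
  from * obtain B where B: "finite B" "\<forall>xs\<in>Y. card ({x \<in> set xs. c < x} - B) \<le> k"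
    unfolding coords_above_le_def by blast
  show "coords_above_le c (X \<union> Y) k"
  proof (rule coords_above_leI[of "A \<union> B"])
    fix xs assume "xs \<in> X \<union> Y"
    moreover have "card ({x \<in> set xs. c < x} - (A \<union> B)) \<le> card ({x \<in> set xs. c < x} - A)"
      "card ({x \<in> set xs. c < x} - (A \<union> B)) \<le> card ({x \<in> set xs. c < x} - B)"
      by (auto intro!: card_mono)
    ultimately show "card ({x \<in> set xs. c < x} - (A \<union> B)) \<le> k"
      using A(2) B(2) order_trans by blast
  qed (use A B in auto)
qed (auto simp: coords_above_le_def)

text \<open>Ensures that the \<open>LEAST\<close> in \<open>dim_above\<close> ranges over a
  non-empty set of bounds.\<close>

lemma coords_above_le_length:
  assumes "X \<in> definable_sets M n" shows "coords_above_le c X n"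
proof (rule coords_above_leI[of "{}"])
  fix xs assume "xs \<in> X"
  have "card ({x \<in> set xs. c < x} - {}) \<le> card (set xs)" by (auto intro: card_mono)
  also have "\<dots> \<le> n" using card_length[of xs] definable_length[OF assms \<open>xs \<in> X\<close>] by simp
  finally show "card ({x \<in> set xs. c < x} - {}) \<le> n" .
qed simp

lemma dim_above_empty: "dim_above c {} = None"
  by (simp add: dim_above_def definable_imp_all_definable[OF definable_empty zero_less_one])

text \<open>The bounds form an up-set of the natural numbers, so dimensions are compared from here
  on by comparing these up-sets.\<close>

lemma dim_above_eq_Some_iff:
  assumes "X \<in> definable_sets DLO n" "n > 0" "X \<noteq> {}"
  shows "dim_above c X = Some k \<longleftrightarrow> (\<forall>j. coords_above_le c X j \<longleftrightarrow> k \<le> j)"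
proof -
  have "(LEAST k. coords_above_le c X k) = k \<longleftrightarrow> (\<forall>j. coords_above_le c X j \<longleftrightarrow> k \<le> j)"
  proof
    assume k: "(LEAST k. coords_above_le c X k) = k"
    show "\<forall>j. coords_above_le c X j \<longleftrightarrow> k \<le> j"
      using LeastI[of "coords_above_le c X", OF coords_above_le_length[OF assms(1)]] k
        coords_above_le_mono Least_le[of "coords_above_le c X"] by blast
  qed (auto intro: Least_equality)
  then show ?thesis
    using assms definable_imp_all_definable[OF assms(1,2)] by (simp add: dim_above_def)
qed

lemma dim_above_nonempty:
  assumes "X \<in> definable_sets DLO n" "n > 0" "X \<noteq> {}"
  obtains k where "dim_above c X = Some k" "\<And>j. coords_above_le c X j \<longleftrightarrow> k \<le> j"
proof -
  have "dim_above c X = Some (LEAST k. coords_above_le c X k)"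
    using assms definable_imp_all_definable[OF assms(1,2)] by (simp add: dim_above_def)
  with dim_above_eq_Some_iff[OF assms] that show ?thesis by blast
qed

lemma dim_above_Un:
  assumes "X \<in> definable_sets DLO n" "Y \<in> definable_sets DLO n" "n > 0"
  shows "dim_above c (X \<union> Y) = max (dim_above c X) (dim_above c Y)"
proof (cases "X = {} \<or> Y = {}")
  case True
  then show ?thesis by (auto simp: dim_above_empty max_def dest: less_eq_option_None_is_None)
next
  case False
  then obtain k l where k: "dim_above c X = Some k" "\<And>j. coords_above_le c X j \<longleftrightarrow> k \<le> j"
    and l: "dim_above c Y = Some l" "\<And>j. coords_above_le c Y j \<longleftrightarrow> l \<le> j"
    using dim_above_nonempty assms by metis
  have "dim_above c (X \<union> Y) = Some (max k l)"
    using dim_above_eq_Some_iff[OF definable_Un[OF assms(1,2)] assms(3)] False k(2) l(2)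
    by (simp add: coords_above_le_Un)
  with k l show ?thesis by (simp add: max_def)
qed

section \<open>Finite and infinite fibres, and additivity of the dimension\<close>

lemma coords_above_le_0_singletons_iff:
  "coords_above_le c {[y] | y. P y} 0 \<longleftrightarrow> finite {y. c < y \<and> P y}"
proof
  assume "coords_above_le c {[y] | y. P y} 0"
  then obtain A where A: "finite A"
    "\<And>xs. xs \<in> {[y] | y. P y} \<Longrightarrow> card ({x \<in> set xs. c < x} - A) \<le> 0"
    by (elim coords_above_leE) auto
  have "{y. c < y \<and> P y} \<subseteq> A"
  proof
    fix y assume y: "y \<in> {y. c < y \<and> P y}"
    with A(2)[of "[y]"] have "card ({x \<in> {y}. c < x} - A) = 0" by simp
    with y show "y \<in> A" by auto
  qed
  with A(1) show "finite {y. c < y \<and> P y}" by (rule finite_subset[rotated])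
next
  assume "finite {y. c < y \<and> P y}"
  then show "coords_above_le c {[y] | y. P y} 0"
    by (rule coords_above_leI) auto
qed

text \<open>On one-element lists 1 is always a bound, so only the bound 0 is at stake, and it
  requires an exceptional set containing every listed point above \<open>c\<close>.\<close>

lemma dim_above_singletons:
  assumes "{[y] | y. P y} \<in> definable_sets DLO 1" "P y"
  shows "dim_above c {[y] | y. P y} = Some (if finite {y. c < y \<and> P y} then 0 else 1)"
proof -
  have "coords_above_le c {[y] | y. P y} j \<longleftrightarrow> (if finite {y. c < y \<and> P y} then 0 else 1) \<le> j" for j
    using coords_above_le_0_singletons_iff[of c P]
      coords_above_le_mono[OF coords_above_le_length[OF assms(1)], of j c]
      coords_above_le_mono[of c "{[y] | y. P y}" 0 j]
    by (cases "j = 0") (auto simp: Suc_le_eq)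
  moreover have "{[y] | y. P y} \<noteq> {}" using assms(2) by blast
  ultimately show ?thesis
    using dim_above_eq_Some_iff[OF assms(1) zero_less_one] by blast
qed

text \<open>An infinite set cannot fit into the finite \<open>A \<union> set x\<close>. Conversely,
  a point outside it can be moved to infinitely many places while the support and the base tuple
  stay fixed.\<close>

lemma infinite_fibre_above_iff:
  fixes X :: "'a::unbounded_dense_linorder list set"
  assumes A: "finite A" "supports A (Suc n) X" and x: "length x = n"
  shows "infinite {y. c < y \<and> x @ [y] \<in> X} \<longleftrightarrow> (\<exists>y. c < y \<and> y \<notin> A \<union> set x \<and> x @ [y] \<in> X)"
proof
  assume "infinite {y. c < y \<and> x @ [y] \<in> X}"
  then have "infinite ({y. c < y \<and> x @ [y] \<in> X} - (A \<union> set x))"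
    using A(1) by (metis Diff_infinite_finite List.finite_set finite_Un)
  then have "{y. c < y \<and> x @ [y] \<in> X} - (A \<union> set x) \<noteq> {}" by (metis finite.emptyI)
  then show "\<exists>y. c < y \<and> y \<notin> A \<union> set x \<and> x @ [y] \<in> X" by blast
next
  assume "\<exists>y. c < y \<and> y \<notin> A \<union> set x \<and> x @ [y] \<in> X"
  then obtain y where y: "c < y" "y \<notin> A \<union> set x" "x @ [y] \<in> X" by blast
  \<comment> \<open>\<open>c\<close> is fixed as well, so that all copies of \<open>y\<close> stay
    above it.\<close>
  define R where "R = Id_on (insert c (A \<union> set x))"
  have "finite R" using A(1) by (simp add: R_def Id_on_def)
  moreover have "y \<notin> Domain R" using y by (auto simp: R_def)
  ultimately have "infinite {z. order_preserving (insert (y, z) R)}"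
    using infinite_extensions order_preserving_Id R_def by blast
  moreover have "{z. order_preserving (insert (y, z) R)} \<subseteq> {y. c < y \<and> x @ [y] \<in> X}"
  proof
    fix z assume "z \<in> {z. order_preserving (insert (y, z) R)}"
    then have z: "order_preserving (insert (y, z) R)" by simp
    have "order_preserving (set (zip (x @ [y]) (x @ [z])) \<union> Id_on A)"
      by (rule order_preserving_mono[OF z]) (auto simp: R_def zip_same)
    with supportsD[OF A(2) y(3), of "x @ [z]"] x have "x @ [z] \<in> X" by simp
    moreover have "c < z" using order_preservingD[OF z, of c c y z] y(1)
      by (simp add: R_def Id_on_iff)
    ultimately show "z \<in> {y. c < y \<and> x @ [y] \<in> X}" by simp
  qed
  ultimately show "infinite {y. c < y \<and> x @ [y] \<in> X}" using finite_subset by blast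
qed

text \<open>Elimination of the quantifier "for infinitely many": by
  \<open>infinite_fibre_above_iff\<close> one new point is enough, and a partial isomorphism fixing
  \<open>c\<close> carries it along.\<close>

lemma definable_infinite_fibres_above:
  assumes X: "X \<in> definable_sets DLO (Suc n)"
  shows "{x. length x = n \<and> infinite {y. c < y \<and> x @ [y] \<in> X}} \<in> definable_sets DLO n"
    (is "?B \<in> _")
proof -
  obtain A where A: "finite A" "supports A (Suc n) X" using definable_imp_supported[OF X] .
  have "supports (insert c A) n ?B"
  proof (rule supportsI)
    fix xs ys assume *: "length xs = n" "length ys = n" "xs \<in> ?B"
      "order_preserving (set (zip xs ys) \<union> Id_on (insert c A))"
    then obtain a where a: "c < a" "a \<notin> A \<union> set xs" "xs @ [a] \<in> X"
      using infinite_fibre_above_iff[OF A *(1)] by auto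
    obtain b where b: "order_preserving (insert (a, b) (set (zip xs ys) \<union> Id_on (insert c A)))"
      using order_preserving_extend[OF _ *(4)] A(1) by (auto simp: Id_on_def)
    have "order_preserving (set (zip (xs @ [a]) (ys @ [b])) \<union> Id_on A)"
      by (rule order_preserving_mono[OF b]) (use * in auto)
    with * supportsD[OF A(2) a(3), of "ys @ [b]"] have "ys @ [b] \<in> X" by simp
    moreover have "c < b" using order_preservingD[OF b, of c c a b] a by auto
    \<comment> \<open>New points stay new: by injectivity, an image in \<open>A\<close> or in
      \<open>ys\<close> would force \<open>a\<close> into \<open>A\<close> or into
      \<open>xs\<close>.\<close>
    moreover have "b \<notin> A" using order_preserving_eqD[OF b, of b b a b] a by auto
    moreover have "b \<notin> set ys"
    proof
      assume "b \<in> set ys"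
      then obtain i where i: "i < n" "b = ys ! i" using * by (metis in_set_conv_nth)
      then have "(xs ! i, b) \<in> set (zip xs ys)" using * by (auto simp: set_zip)
      then have "xs ! i = a" using order_preserving_eqD[OF b, of "xs ! i" b a b] by auto
      with i * a show False by auto
    qed
    ultimately show "ys \<in> ?B" using infinite_fibre_above_iff[OF A *(2)] * by auto
  qed
  then show ?thesis
    by (rule supported_imp_definable[rotated]) (use A(1) in auto)
qed

text \<open>Turns the level sets of the fibre dimension into finiteness conditions, as needed for
  their definability and for both additivity lemmas. An infinite fibre is non-empty, so its base
  point lies in the projection.\<close>

lemma fibre_dim_set_dim_above:
  assumes X: "X \<in> definable_sets DLO (Suc n)"
  shows "fibre_dim_set (dim_above c) X 0 =
      butlast ` X - {x. length x = n \<and> infinite {y. c < y \<and> x @ [y] \<in> X}}"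
    and "fibre_dim_set (dim_above c) X 1 =
      {x. length x = n \<and> infinite {y. c < y \<and> x @ [y] \<in> X}}"
proof -
  have dim: "dim_above c (fibre X x) = Some (if finite {y. c < y \<and> x @ [y] \<in> X} then 0 else 1)"
    and len: "length x = n" if "x \<in> butlast ` X" for x
  proof -
    from that obtain xs where xs: "xs \<in> X" "x = butlast xs" by blast
    with X have l: "length xs = Suc n" using definable_length by blast
    then show "length x = n" using xs by simp
    from l have "x @ [last xs] \<in> X" using xs by (metis append_butlast_last_id list.size(3) nat.distinct(1))
    with dim_above_singletons[of "\<lambda>y. x @ [y] \<in> X" "last xs"] definable_fibre[OF X \<open>length x = n\<close>]
    show "dim_above c (fibre X x) = Some (if finite {y. c < y \<and> x @ [y] \<in> X} then 0 else 1)"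
      by (simp add: fibre_def)
  qed
  have "x \<in> butlast ` X" if "infinite {y. c < y \<and> x @ [y] \<in> X}" for x
  proof -
    from that obtain y where "x @ [y] \<in> X" using not_finite_existsD by blast
    then show ?thesis by (intro image_eqI[of _ _ "x @ [y]"]) simp_all
  qed
  then have "x \<in> fibre_dim_set (dim_above c) X 0 \<longleftrightarrow>
        x \<in> butlast ` X - {x. length x = n \<and> infinite {y. c < y \<and> x @ [y] \<in> X}}"
      "x \<in> fibre_dim_set (dim_above c) X 1 \<longleftrightarrow>
        x \<in> {x. length x = n \<and> infinite {y. c < y \<and> x @ [y] \<in> X}}" for x
    using dim[of x] len[of x] unfolding fibre_dim_set_def
    by (cases "x \<in> butlast ` X"; force)+
  then show "fibre_dim_set (dim_above c) X 0 =
      butlast ` X - {x. length x = n \<and> infinite {y. c < y \<and> x @ [y] \<in> X}}"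
    "fibre_dim_set (dim_above c) X 1 =
      {x. length x = n \<and> infinite {y. c < y \<and> x @ [y] \<in> X}}"
    by blast+
qed

lemma definable_fibre_dim_set_dim_above:
  assumes X: "X \<in> definable_sets DLO (Suc n)" and "i \<in> {0, 1}"
  shows "fibre_dim_set (dim_above c) X i \<in> definable_sets DLO n"
proof -
  have "fibre_dim_set (dim_above c) X 0 \<in> definable_sets DLO n"
    "fibre_dim_set (dim_above c) X 1 \<in> definable_sets DLO n"
    unfolding fibre_dim_set_dim_above[OF X]
    by (intro definable_Diff definable_butlast X definable_infinite_fibres_above)+
  with assms(2) show ?thesis by blast
qed

text \<open>Over a set supporting \<open>X\<close>, a fibre that is finite above \<open>c\<close> has no new coordinate above \<open>c\<close>.\<close>

lemma dim_above_finite_fibres: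
  fixes c :: "'a::unbounded_dense_linorder"
  assumes X: "X \<in> definable_sets DLO (Suc n)" and "n > 0"
  defines "B \<equiv> fibre_dim_set (dim_above c) X 0"
  shows "dim_above c {xs \<in> X. butlast xs \<in> B} = dim_above c B"
proof (cases "B = {}")
  case True
  then show ?thesis by simp
next
  case False
  let ?X = "{xs \<in> X. butlast xs \<in> B}"
  have B: "B \<in> definable_sets DLO n"
    unfolding B_def using definable_fibre_dim_set_dim_above[OF X] by simp
  obtain A where A: "finite A" "supports A (Suc n) X" using definable_imp_supported[OF X] .
  have bl: "B \<subseteq> butlast ` ?X" unfolding B_def fibre_dim_set_def by auto
  have "coords_above_le c ?X k \<longleftrightarrow> coords_above_le c B k" for k
  proof
    assume "coords_above_le c ?X k"
    then obtain C where C: "finite C" "\<And>xs. xs \<in> ?X \<Longrightarrow> card ({x \<in> set xs. c < x} - C) \<le> k"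
      by (elim coords_above_leE) blast
    show "coords_above_le c B k"
    proof (rule coords_above_leI[OF C(1)])
      fix x assume "x \<in> B"
      with bl obtain xs where xs: "xs \<in> ?X" "x = butlast xs" by blast
      have "card ({u \<in> set x. c < u} - C) \<le> card ({x \<in> set xs. c < x} - C)"
        using xs by (intro card_mono) (auto dest: in_set_butlastD)
      with C(2)[OF xs(1)] show "card ({u \<in> set x. c < u} - C) \<le> k" by simp
    qed
  next
    assume "coords_above_le c B k"
    then obtain C where C: "finite C" "\<And>xs. xs \<in> B \<Longrightarrow> card ({x \<in> set xs. c < x} - C) \<le> k"
      by (elim coords_above_leE) blast
    \<comment> \<open>A last entry above \<open>c\<close> either lies in \<open>A\<close>, which is
      now discarded too, or repeats an entry of \<open>x\<close>, so the count does not
      grow.\<close>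
    show "coords_above_le c ?X k"
    proof (rule coords_above_leI[of "A \<union> C"])
      fix xs assume xs: "xs \<in> ?X"
      then obtain x y where xy: "xs = x @ [y]" "x \<in> B" "length x = n"
        using definable_length[OF X] by (metis (mono_tags, lifting) append_butlast_last_id
            definable_length[OF B] list.size(3) mem_Collect_eq nat.distinct(1))
      then have "finite {y. c < y \<and> x @ [y] \<in> X}"
        unfolding B_def fibre_dim_set_dim_above[OF X] by blast
      with infinite_fibre_above_iff[OF A xy(3)] xs xy have "c < y \<Longrightarrow> y \<in> A \<union> set x" by blast
      then have "card ({x \<in> set xs. c < x} - (A \<union> C)) \<le> card ({u \<in> set x. c < u} - C)"
        using xy by (intro card_mono) auto
      with C(2)[OF xy(2)] show "card ({x \<in> set xs. c < x} - (A \<union> C)) \<le> k" by simp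
    qed (use A C in auto)
  qed
  moreover obtain k where k: "dim_above c B = Some k" "\<And>j. coords_above_le c B j \<longleftrightarrow> k \<le> j"
    using dim_above_nonempty[OF B \<open>n > 0\<close> False] by metis
  moreover have "?X \<noteq> {}" using False bl by blast
  ultimately have "dim_above c ?X = Some k"
    using dim_above_eq_Some_iff[OF definable_restrict_butlast[OF X B] zero_less_Suc] by blast
  with k(1) show ?thesis by simp
qed

text \<open>The exceptional set \<open>C\<close> is given first, and the last coordinate is then
  chosen to avoid both \<open>C\<close> and the base tuple, which raises the count by exactly one.
  Conversely, no tuple gains more than one from its last entry.\<close>

lemma dim_above_infinite_fibres:
  fixes c :: "'a::unbounded_dense_linorder"
  assumes X: "X \<in> definable_sets DLO (Suc n)" and "n > 0"
  defines "B \<equiv> fibre_dim_set (dim_above c) X 1"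
  shows "dim_above c {xs \<in> X. butlast xs \<in> B} = map_option Suc (dim_above c B)"
proof (cases "B = {}")
  case True
  then show ?thesis by (simp add: dim_above_empty)
next
  case False
  let ?X = "{xs \<in> X. butlast xs \<in> B}"
  have B: "B \<in> definable_sets DLO n"
    unfolding B_def using definable_fibre_dim_set_dim_above[OF X] by simp
  have new: "\<exists>y. c < y \<and> y \<notin> C \<union> set x \<and> x @ [y] \<in> ?X" if "x \<in> B" "finite C" for x C
  proof -
    from that have "infinite {y. c < y \<and> x @ [y] \<in> X}"
      unfolding B_def fibre_dim_set_dim_above[OF X] by blast
    then have "\<not> {y. c < y \<and> x @ [y] \<in> X} \<subseteq> C \<union> set x"
      using that(2) by (meson List.finite_set finite_UnI finite_subset)
    with that(1) show ?thesis by auto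
  qed
  have card_snoc: "card ({u \<in> set (x @ [y]). c < u} - C) = Suc (card ({u \<in> set x. c < u} - C))"
    if "c < y" "y \<notin> C \<union> set x" for x y C
  proof -
    have "{u \<in> set (x @ [y]). c < u} - C = insert y ({u \<in> set x. c < u} - C)" using that by auto
    with that show ?thesis by simp
  qed
  \<comment> \<open>The bound 0 is excluded separately, since \<open>step\<close> speaks of
    successors only.\<close>
  have not0: "\<not> coords_above_le c ?X 0"
  proof
    assume "coords_above_le c ?X 0"
    then obtain C where C: "finite C" "\<And>xs. xs \<in> ?X \<Longrightarrow> card ({x \<in> set xs. c < x} - C) \<le> 0"
      by (elim coords_above_leE) blast
    from False obtain x where "x \<in> B" by blast
    with new[OF _ C(1)] obtain y where y: "c < y" "y \<notin> C \<union> set x" "x @ [y] \<in> ?X" by blast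
    with C(2)[OF y(3)] card_snoc[OF y(1,2)] show False by auto
  qed
  have step: "coords_above_le c ?X (Suc k) \<longleftrightarrow> coords_above_le c B k" for k
  proof
    assume "coords_above_le c ?X (Suc k)"
    then obtain C where C: "finite C" "\<And>xs. xs \<in> ?X \<Longrightarrow> card ({x \<in> set xs. c < x} - C) \<le> Suc k"
      by (elim coords_above_leE) blast
    show "coords_above_le c B k"
    proof (rule coords_above_leI[OF C(1)])
      fix x assume "x \<in> B"
      with new[OF _ C(1)] obtain y where y: "c < y" "y \<notin> C \<union> set x" "x @ [y] \<in> ?X" by blast
      with C(2)[OF y(3)] card_snoc[OF y(1,2)] show "card ({u \<in> set x. c < u} - C) \<le> k" by simp
    qed
  next
    assume "coords_above_le c B k"
    then obtain C where C: "finite C" "\<And>xs. xs \<in> B \<Longrightarrow> card ({x \<in> set xs. c < x} - C) \<le> k"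
      by (elim coords_above_leE) blast
    show "coords_above_le c ?X (Suc k)"
    proof (rule coords_above_leI[OF C(1)])
      fix xs assume xs: "xs \<in> ?X"
      then have "xs \<noteq> []" using definable_length[OF X] by fastforce
      then have "set xs = insert (last xs) (set (butlast xs))"
        by (metis append_butlast_last_id list.simps(15) rotate1.simps(2) set_rotate1)
      then have "card ({x \<in> set xs. c < x} - C) \<le>
          card (insert (last xs) ({x \<in> set (butlast xs). c < x} - C))"
        by (intro card_mono) auto
      also have "\<dots> \<le> Suc (card ({x \<in> set (butlast xs). c < x} - C))"
        by (simp add: card_insert_if)
      finally show "card ({x \<in> set xs. c < x} - C) \<le> Suc k"
        using C(2)[of "butlast xs"] xs by simp
    qed
  qed
  obtain k where k: "dim_above c B = Some k" "\<And>j. coords_above_le c B j \<longleftrightarrow> k \<le> j"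
    using dim_above_nonempty[OF B \<open>n > 0\<close> False] by metis
  have "coords_above_le c ?X j \<longleftrightarrow> Suc k \<le> j" for j
    using not0 step k(2) by (cases j) auto
  moreover have "?X \<noteq> {}" using False new by blast
  ultimately have "dim_above c ?X = Some (Suc k)"
    using dim_above_eq_Some_iff[OF definable_restrict_butlast[OF X B]] by blast
  with k(1) show ?thesis by simp
qed

lemma definable_all_singletons: "{[a] | a. True} \<in> definable_sets DLO 1"
  by (rule supported_imp_definable[of "{}"]) (auto simp: supports_def length_Suc_conv)

lemma dimension_function_dim_above:
  fixes c :: "'a::unbounded_dense_linorder"
  shows "dimension_function DLO (dim_above c)"
  unfolding dimension_function_def
proof (intro conjI allI impI ballI)
  fix X :: "'a list set" assume "X \<notin> all_definable_sets DLO"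
  then show "dim_above c X = undefined" by (simp add: dim_above_def)
next
  show "dim_above c {} = None" by (rule dim_above_empty)
next
  fix a show "dim_above c {[a]} = Some 0"
    using dim_above_singletons[of "\<lambda>y. y = a" a c] definable_singleton[of a] by simp
next
  have "{y. c < y} = {c<..}" by auto
  then show "dim_above c {[a] | a. True} = Some 1"
    using dim_above_singletons[of "\<lambda>y. True" c c] definable_all_singletons infinite_Ioi[of c]
    by simp
next
  fix n :: nat and X Y :: "'a list set"
  assume "0 < n" "X \<in> definable_sets DLO n" "Y \<in> definable_sets DLO n"
  then show "dim_above c (X \<union> Y) = max (dim_above c X) (dim_above c Y)"
    using dim_above_Un by blast
next
  fix n :: nat and X :: "'a list set" and \<sigma>
  assume *: "0 < n" "X \<in> definable_sets DLO n" "\<sigma> permutes {..<n}"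
  have "set (permute_list \<sigma> xs) = set xs" if "xs \<in> X" for xs
    using definable_length[OF *(2) that] *(3) by simp
  then have "coords_above_le c (permute_list \<sigma> ` X) = coords_above_le c X"
    unfolding coords_above_le_def by (intro ext) simp
  moreover have "permute_list \<sigma> ` X \<in> all_definable_sets DLO" "X \<in> all_definable_sets DLO"
    using definable_imp_all_definable definable_permute * by blast+
  ultimately show "dim_above c (permute_list \<sigma> ` X) = dim_above c X" by (simp add: dim_above_def)
next
  fix n :: nat and X :: "'a list set" and i :: nat
  assume *: "0 < n" "1 < n" "X \<in> definable_sets DLO n" "i \<in> {0, 1}"
  then obtain m where m: "n = Suc m" "m > 0" by (cases n) auto
  with * have X: "X \<in> definable_sets DLO (Suc m)" by simp
  show "fibre_dim_set (dim_above c) X i \<in> definable_sets DLO (n - 1)"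
    using definable_fibre_dim_set_dim_above[OF X *(4)] m by simp
  show "dim_above c {xs \<in> X. butlast xs \<in> fibre_dim_set (dim_above c) X i} =
      map_option (\<lambda>k. k + i) (dim_above c (fibre_dim_set (dim_above c) X i))"
  proof (cases "i = 0")
    case True
    then show ?thesis
      using dim_above_finite_fibres[OF X m(2), of c] by (simp add: option.map_ident)
  next
    case False
    with *(4) have "i = 1" by simp
    then show ?thesis using dim_above_infinite_fibres[OF X m(2), of c] by simp
  qed
qed

lemma inj_dim_above: "inj (dim_above :: 'a::unbounded_dense_linorder \<Rightarrow> _)"
proof (rule linorder_injI)
  fix c c' :: 'a assume "c < c'"
  let ?I = "{[y] | y. c < y \<and> y < c'}"
  have "?I \<in> definable_sets DLO 1"
  proof (rule supported_imp_definable[of "{c, c'}"])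
    show "supports {c, c'} 1 ?I"
    proof (rule supportsI)
      fix xs ys assume *: "length xs = 1" "length ys = 1" "xs \<in> ?I"
        "order_preserving (set (zip xs ys) \<union> Id_on {c, c'})"
      then obtain x y where xy: "xs = [x]" "ys = [y]" by (auto simp: length_Suc_conv)
      with * order_preservingD[OF *(4), of c c x y] order_preservingD[OF *(4), of x y c' c']
      show "ys \<in> ?I" by auto
    qed
  qed auto
  moreover obtain y where "c < y" "y < c'" using \<open>c < c'\<close> dense by blast
  ultimately have dim: "dim_above e ?I = Some (if finite {y. e < y \<and> c < y \<and> y < c'} then 0 else 1)" for e
    using dim_above_singletons[of "\<lambda>y. c < y \<and> y < c'"] by blast
  have "{y. c < y \<and> c < y \<and> y < c'} = {c<..<c'}" "{y. c' < y \<and> c < y \<and> y < c'} = {}" by auto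
  with dim[of c] dim[of c'] \<open>c < c'\<close>
  have "dim_above c ?I = Some 1" "dim_above c' ?I = Some 0" by simp_all
  then show "dim_above c \<noteq> dim_above c'" by auto
qed

section \<open>A dimension function is determined by its values on intervals and rays\<close>

lemma dimension_functionD:
  fixes d :: "'a::unbounded_dense_linorder list set \<Rightarrow> nat option"
  assumes "dimension_function DLO d"
  shows "X \<notin> all_definable_sets DLO \<Longrightarrow> d X = undefined"
    and "d {} = None" and "d {[a]} = Some 0" and "d {[a] | a. True} = Some 1"
    and "n > 0 \<Longrightarrow> X \<in> definable_sets DLO n \<Longrightarrow> Y \<in> definable_sets DLO n \<Longrightarrow>
      d (X \<union> Y) = max (d X) (d Y)"
    and "n > 0 \<Longrightarrow> X \<in> definable_sets DLO (Suc n) \<Longrightarrow> i \<in> {0, 1} \<Longrightarrow>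
      fibre_dim_set d X i \<in> definable_sets DLO n"
    and "n > 0 \<Longrightarrow> X \<in> definable_sets DLO (Suc n) \<Longrightarrow> i \<in> {0, 1} \<Longrightarrow>
      d {xs \<in> X. butlast xs \<in> fibre_dim_set d X i} = map_option (\<lambda>k. k + i) (d (fibre_dim_set d X i))"
proof -
  note * = assms[unfolded dimension_function_def]
  show "X \<notin> all_definable_sets DLO \<Longrightarrow> d X = undefined" "d {} = None" "d {[a]} = Some 0"
    "d {[a] | a. True} = Some 1"
    using * by blast+
  show "n > 0 \<Longrightarrow> X \<in> definable_sets DLO n \<Longrightarrow> Y \<in> definable_sets DLO n \<Longrightarrow>
      d (X \<union> Y) = max (d X) (d Y)"
    using * by blast
  from *[THEN conjunct2, THEN conjunct2, THEN spec, of "Suc n", THEN mp, OF zero_less_Suc]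
  have **: "1 < Suc n \<longrightarrow> (\<forall>X\<in>definable_sets DLO (Suc n). \<forall>i\<in>{0, 1}.
      fibre_dim_set d X i \<in> definable_sets DLO n \<and>
      d {xs \<in> X. butlast xs \<in> fibre_dim_set d X i} = map_option (\<lambda>k. k + i) (d (fibre_dim_set d X i)))"
    unfolding diff_Suc_1 by blast
  have "fibre_dim_set d X i \<in> definable_sets DLO n \<and>
      d {xs \<in> X. butlast xs \<in> fibre_dim_set d X i} = map_option (\<lambda>k. k + i) (d (fibre_dim_set d X i))"
    if "n > 0" "X \<in> definable_sets DLO (Suc n)" "i \<in> {0, 1}"
  proof -
    from that(1) have "1 < Suc n" by simp
    with ** that(2,3) show ?thesis by blast
  qed
  then show "n > 0 \<Longrightarrow> X \<in> definable_sets DLO (Suc n) \<Longrightarrow> i \<in> {0, 1} \<Longrightarrow>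
      fibre_dim_set d X i \<in> definable_sets DLO n"
    "n > 0 \<Longrightarrow> X \<in> definable_sets DLO (Suc n) \<Longrightarrow> i \<in> {0, 1} \<Longrightarrow>
      d {xs \<in> X. butlast xs \<in> fibre_dim_set d X i} = map_option (\<lambda>k. k + i) (d (fibre_dim_set d X i))"
    by blast+
qed

text \<open>The union axiom makes \<open>d\<close> monotone, and \<open>Y\<close> lies between a
  point and the whole of \<open>M\<close>. Hence in arity one, knowing which non-empty sets have
  dimension zero is knowing \<open>d\<close>.\<close>

lemma dimension_1_cases:
  fixes d :: "'a::unbounded_dense_linorder list set \<Rightarrow> nat option"
  assumes d: "dimension_function DLO d" and Y: "Y \<in> definable_sets DLO 1" "Y \<noteq> {}"
  shows "d Y = Some 0 \<or> d Y = Some 1"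
proof -
  obtain a where a: "[a] \<in> Y"
    using Y definable_length[OF Y(1)] by (force simp: length_Suc_conv)
  have "Y \<union> {[a] | a. True} = {[a] | a. True}"
    using definable_length[OF Y(1)] by (force simp: length_Suc_conv)
  with dimension_functionD(4)[OF d] dimension_functionD(5)[OF d zero_less_one Y(1) definable_all_singletons]
  have "d Y \<le> Some 1" by (metis max.cobounded1)
  moreover have "{[a]} \<union> Y = Y" using a by blast
  with dimension_functionD(3)[OF d, of a] dimension_functionD(5)[OF d zero_less_one definable_singleton Y(1)]
  have "Some 0 \<le> d Y" by (metis max.cobounded1)
  ultimately show ?thesis by (cases "d Y") (auto simp: le_Suc_eq)
qed

text \<open>The fibres of \<open>gap_family\<close> are all intervals and rays: equal endpoints code a ray
  to the right, endpoints in the wrong order a ray to the left.\<close>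

definition gap_family :: "'a::linorder list set" where
  "gap_family = {[a, b, y] | a b y. a < y \<and> y < b \<or> a = b \<and> a < y \<or> b < a \<and> y < a}"

lemma definable_gap_family: "gap_family \<in> definable_sets DLO 3"
proof (rule supported_imp_definable[of "{}"])
  show "supports {} 3 gap_family"
  proof (rule supportsI)
    fix xs ys assume *: "length xs = 3" "length ys = 3" "xs \<in> gap_family"
      "order_preserving (set (zip xs ys) \<union> Id_on {})"
    obtain a b y where xs: "xs = [a, b, y]" using *(1) by (auto simp: numeral_3_eq_3 length_Suc_conv)
    obtain a' b' y' where ys: "ys = [a', b', y']" using *(2) by (auto simp: numeral_3_eq_3 length_Suc_conv)
    have op: "order_preserving {(a, a'), (b, b'), (y, y')}" using *(4) by (simp add: xs ys)
    have "a < y \<longleftrightarrow> a' < y'" "y < b \<longleftrightarrow> y' < b'" "b < a \<longleftrightarrow> b' < a'" "y < a \<longleftrightarrow> y' < a'"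
      by (rule order_preservingD[OF op]; simp)+
    moreover have "a = b \<longleftrightarrow> a' = b'" by (rule order_preserving_eqD[OF op]) simp_all
    ultimately show "ys \<in> gap_family" using *(3) unfolding gap_family_def xs ys by simp
  qed
qed (auto simp: gap_family_def)

text \<open>The set of realisations of the order type of \<open>y\<close> over \<open>A\<close>: a
  single point if \<open>y\<close> is in \<open>A\<close>, otherwise the part of the complement of
  \<open>A\<close> that lies in the same cut as \<open>y\<close>.\<close>

definition gap :: "'a::linorder set \<Rightarrow> 'a \<Rightarrow> 'a set" where
  "gap A y = {z. \<forall>a\<in>A. (a < z \<longleftrightarrow> a < y) \<and> (z < a \<longleftrightarrow> y < a)}"

lemma gap_self: "y \<in> gap A y"
  unfolding gap_def by simp

lemma gap_element:
  assumes "a \<in> A" shows "gap A a = {a}"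
proof -
  have "\<not> a < z" "\<not> z < a" if "z \<in> gap A a" for z
    using that assms unfolding gap_def by blast+
  then have "z = a" if "z \<in> gap A a" for z using that linorder_neqE by blast
  with gap_self show ?thesis by blast
qed

lemma gap_empty: "gap {} y = UNIV"
  unfolding gap_def by simp

lemma finite_gaps:
  assumes "finite A" shows "finite (range (gap A))"
proof -
  let ?f = "\<lambda>(L, U). {z. \<forall>a\<in>A. (a < z \<longleftrightarrow> a \<in> L) \<and> (z < a \<longleftrightarrow> a \<in> U)}"
  have "gap A y = ?f ({a \<in> A. a < y}, {a \<in> A. y < a})" for y
    unfolding gap_def by auto
  then have "range (gap A) \<subseteq> ?f ` (Pow A \<times> Pow A)" by blast
  then show ?thesis by (rule finite_subset) (simp add: assms)
qed

text \<open>The endpoints are the parameters nearest to \<open>y\<close> on either side.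
  \<open>A\<close> is non-empty because the gap over no parameters is the whole order, which is
  neither an interval nor a ray.\<close>

lemma gap_eq_fibre:
  fixes A :: "'a::unbounded_dense_linorder set"
  assumes A: "finite A" "A \<noteq> {}" and y: "y \<notin> A"
  obtains a b where "(\<lambda>z. [z]) ` gap A y = fibre gap_family [a, b]"
proof -
  define L U where "L = {a \<in> A. a < y}" and "U = {a \<in> A. y < a}"
  have fin: "finite L" "finite U" using A by (auto simp: L_def U_def)
  have side: "a < y \<or> y < a" if "a \<in> A" for a using that y by (metis linorder_neqE)
  then have LU: "A = L \<union> U" unfolding L_def U_def by blast
  have gap: "z \<in> gap A y \<longleftrightarrow> (\<forall>a\<in>L. a < z) \<and> (\<forall>a\<in>U. z < a)" for z
  proof
    assume z: "(\<forall>a\<in>L. a < z) \<and> (\<forall>a\<in>U. z < a)"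
    have "(a < z \<longleftrightarrow> a < y) \<and> (z < a \<longleftrightarrow> y < a)" if "a \<in> A" for a
      using side[OF that]
    proof
      assume "a < y"
      moreover from this have "a < z" using z that by (simp add: L_def)
      ultimately show ?thesis using less_asym by blast
    next
      assume "y < a"
      moreover from this have "z < a" using z that by (simp add: U_def)
      ultimately show ?thesis using less_asym by blast
    qed
    then show "z \<in> gap A y" unfolding gap_def by blast
  qed (simp add: gap_def L_def U_def)
  have fib: "[z] \<in> fibre gap_family [a, b] \<longleftrightarrow> a < z \<and> z < b \<or> a = b \<and> a < z \<or> b < a \<and> z < a" for z a b :: 'a
    by (simp add: fibre_def gap_family_def)
  have eq: "(\<lambda>z. [z]) ` gap A y = fibre gap_family [a, b]"
    if "\<And>z. z \<in> gap A y \<longleftrightarrow> [z] \<in> fibre gap_family [a, b]" for a b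
  proof (rule set_eqI)
    fix xs :: "'a list"
    show "xs \<in> (\<lambda>z. [z]) ` gap A y \<longleftrightarrow> xs \<in> fibre gap_family [a, b]"
    proof (cases "\<exists>z. xs = [z]")
      case True
      then show ?thesis using that by auto
    qed (auto simp: fibre_def)
  qed
  consider "L \<noteq> {}" "U \<noteq> {}" | "L \<noteq> {}" "U = {}" | "L = {}" "U \<noteq> {}" using A(2) LU by blast
  then show ?thesis
  proof cases
    case 1
    have less: "Max L < Min U" using 1 fin by (auto simp: L_def U_def)
    have "z \<in> gap A y \<longleftrightarrow> [z] \<in> fibre gap_family [Max L, Min U]" for z
      using Max_less_iff[OF fin(1) 1(1), of z] Min_gr_iff[OF fin(2) 1(2), of z] less less_asym less_irrefl
      unfolding gap fib by metis
    from that[OF eq[OF this]] show ?thesis .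
  next
    case 2
    have "z \<in> gap A y \<longleftrightarrow> [z] \<in> fibre gap_family [Max L, Max L]" for z
      using 2 fin unfolding gap fib by auto
    from that[OF eq[OF this]] show ?thesis .
  next
    case 3
    \<comment> \<open>There is no lower endpoint; any point below \<open>Min U\<close> signals a ray
      to the left.\<close>
    obtain b where b: "b < Min U" using lt_ex by blast
    have "\<not> (Min U < z \<and> z < b)" "Min U \<noteq> b" for z using b less_trans less_asym by blast+
    then have "z \<in> gap A y \<longleftrightarrow> [z] \<in> fibre gap_family [Min U, b]" for z
      using Min_gr_iff[OF fin(2) 3(2), of z] 3(1) b unfolding gap fib by auto
    from that[OF eq[OF this]] show ?thesis .
  qed
qed

lemma definable_gap:
  assumes "finite A" shows "(\<lambda>z. [z]) ` gap A y \<in> definable_sets DLO 1"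
proof (rule supported_imp_definable[OF assms])
  show "supports A 1 ((\<lambda>z. [z]) ` gap A y)"
  proof (rule supportsI)
    fix xs ys assume *: "length xs = 1" "length ys = 1" "xs \<in> (\<lambda>z. [z]) ` gap A y"
      "order_preserving (set (zip xs ys) \<union> Id_on A)"
    then obtain x z where xz: "xs = [x]" "ys = [z]" "x \<in> gap A y" by (auto simp: length_Suc_conv)
    have "(a < x \<longleftrightarrow> a < z) \<and> (x < a \<longleftrightarrow> z < a)" if "a \<in> A" for a
      using order_preservingD[OF *(4), of a a x z] order_preservingD[OF *(4), of x z a a] that
      by (simp add: xz Id_on_iff)
    with xz(3) have "z \<in> gap A y" unfolding gap_def by blast
    with xz(2) show "ys \<in> (\<lambda>z. [z]) ` gap A y" by blast
  qed
qed auto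

text \<open>This is o-minimality: moving \<open>y\<close> within its gap is a partial isomorphism
  fixing \<open>A\<close>, so a set with support \<open>A\<close> is a union of gaps over
  \<open>A\<close>. By \<open>finite_gaps\<close> only finitely many are distinct.\<close>

lemma definable_1_eq_Union_gaps:
  assumes Y: "Y \<in> definable_sets DLO 1"
  obtains A where "finite A" "Y = \<Union>((\<lambda>y. (\<lambda>z. [z]) ` gap A y) ` {y. [y] \<in> Y})"
proof -
  obtain A where A: "finite A" "supports A 1 Y" using definable_imp_supported[OF Y] .
  have sub: "[z] \<in> Y" if "[y] \<in> Y" "z \<in> gap A y" for y z
  proof -
    have "order_preserving (set (zip [y] [z]) \<union> Id_on A)"
      using that(2) unfolding order_preserving_def gap_def by (auto simp: Id_on_iff)
    with supportsD[OF A(2) that(1), of "[z]"] show ?thesis by simp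
  qed
  have "Y = \<Union>((\<lambda>y. (\<lambda>z. [z]) ` gap A y) ` {y. [y] \<in> Y})"
  proof (intro set_eqI iffI)
    fix xs assume xs: "xs \<in> Y"
    then obtain y where "xs = [y]" using definable_length[OF Y] by (auto simp: length_Suc_conv)
    with xs gap_self show "xs \<in> \<Union>((\<lambda>y. (\<lambda>z. [z]) ` gap A y) ` {y. [y] \<in> Y})" by blast
  qed (use sub in blast)
  with A(1) that show ?thesis by blast
qed

section \<open>Comparing two dimension functions\<close>

lemma dimension_eq_Union:
  fixes d d' :: "'a::unbounded_dense_linorder list set \<Rightarrow> nat option"
  assumes d: "dimension_function DLO d" "dimension_function DLO d'" and n: "n > 0"
    and F: "finite F" "\<And>X. X \<in> F \<Longrightarrow> X \<in> definable_sets DLO n" "\<And>X. X \<in> F \<Longrightarrow> d X = d' X"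
  shows "d (\<Union>F) = d' (\<Union>F)"
proof -
  have "\<Union>F \<in> definable_sets DLO n \<and> d (\<Union>F) = d' (\<Union>F)"
    using F
  proof (induction F rule: finite_induct)
    case empty
    show ?case using d[THEN dimension_functionD(2)] definable_empty by simp
  next
    case (insert X F)
    then have X: "X \<in> definable_sets DLO n" "d X = d' X"
      and UF: "\<Union>F \<in> definable_sets DLO n" "d (\<Union>F) = d' (\<Union>F)" by blast+
    have "\<Union>(insert X F) = X \<union> \<Union>F" by blast
    with definable_Un[OF X(1) UF(1)] d[THEN dimension_functionD(5), OF n X(1) UF(1)] X UF
    show ?case by simp
  qed
  then show ?thesis by blast
qed

lemma dimension_eq_definable_1:
  fixes d d' :: "'a::unbounded_dense_linorder list set \<Rightarrow> nat option"
  assumes d: "dimension_function DLO d" "dimension_function DLO d'"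
    and eq: "fibre_dim_set d gap_family 0 = fibre_dim_set d' gap_family 0"
    and Y: "Y \<in> definable_sets DLO 1"
  shows "d Y = d' Y"
proof -
  obtain A where A: "finite A" and Y_eq: "Y = \<Union>((\<lambda>y. (\<lambda>z. [z]) ` gap A y) ` {y. [y] \<in> Y})"
    using definable_1_eq_Union_gaps[OF Y] .
  have gap: "d ((\<lambda>z. [z]) ` gap A y) = d' ((\<lambda>z. [z]) ` gap A y)" for y
  proof -
    consider "A = {}" | "y \<in> A" | "A \<noteq> {}" "y \<notin> A" by blast
    then show ?thesis
    proof cases
      case 1
      \<comment> \<open>The whole order is no fibre of \<open>gap_family\<close>; its dimension is
        prescribed by the axioms.\<close>
      have "(\<lambda>z. [z]) ` gap A y = {[a] | a. True}" by (auto simp: 1 gap_empty)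
      then show ?thesis using d[THEN dimension_functionD(4)] by simp
    next
      case 2
      then show ?thesis using d[THEN dimension_functionD(3)] by (simp add: gap_element)
    next
      case 3
      then obtain a b where ab: "(\<lambda>z. [z]) ` gap A y = fibre gap_family [a, b]"
        using gap_eq_fibre[OF A] by blast
      let ?G = "fibre gap_family [a, b]"
      from ab gap_self[of y A] have "[y] \<in> ?G" by blast
      then have "[a, b, y] \<in> gap_family" by (simp add: fibre_def)
      then have mem: "[a, b] \<in> butlast ` gap_family" by (intro image_eqI[of _ _ "[a, b, y]"]) simp_all
      have G: "?G \<in> definable_sets DLO 1" using definable_gap[OF A, of y] ab by simp
      \<comment> \<open>A non-empty fibre has dimension 0 or 1, so it suffices that both functions
        agree on whether it is 0.\<close>
      have "d ?G = Some 0 \<longleftrightarrow> [a, b] \<in> fibre_dim_set d gap_family 0"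
        "d' ?G = Some 0 \<longleftrightarrow> [a, b] \<in> fibre_dim_set d' gap_family 0"
        using mem unfolding fibre_dim_set_def by blast+
      then have "d ?G = Some 0 \<longleftrightarrow> d' ?G = Some 0" using eq by simp
      moreover have "?G \<noteq> {}" using \<open>[y] \<in> ?G\<close> by blast
      ultimately have "d ?G = d' ?G"
        using dimension_1_cases[OF d(1) G] dimension_1_cases[OF d(2) G] by auto
      with ab show ?thesis by simp
    qed
  qed
  have "finite ((\<lambda>y. (\<lambda>z. [z]) ` gap A y) ` {y. [y] \<in> Y})"
  proof (rule finite_subset)
    show "(\<lambda>y. (\<lambda>z. [z]) ` gap A y) ` {y. [y] \<in> Y} \<subseteq> (`) (\<lambda>z. [z]) ` range (gap A)" by blast
  qed (use finite_gaps[OF A] in simp)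
  from dimension_eq_Union[OF d zero_less_one this] gap definable_gap[OF A]
  have "d (\<Union>((\<lambda>y. (\<lambda>z. [z]) ` gap A y) ` {y. [y] \<in> Y})) = d' (\<Union>((\<lambda>y. (\<lambda>z. [z]) ` gap A y) ` {y. [y] \<in> Y}))"
    by blast
  with Y_eq show ?thesis by simp
qed

text \<open>Fibre dimensions are values in arity one, so \<open>d\<close> and \<open>d'\<close> cut
  \<open>X\<close> into the same two parts; the fibre axiom reads the dimension of each part off its
  base, which has smaller arity.\<close>

lemma dimension_eq_definable:
  fixes d d' :: "'a::unbounded_dense_linorder list set \<Rightarrow> nat option"
  assumes d: "dimension_function DLO d" "dimension_function DLO d'"
    and eq1: "\<And>Y. Y \<in> definable_sets DLO 1 \<Longrightarrow> d Y = d' Y"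
    and X: "X \<in> definable_sets DLO (Suc n)"
  shows "d X = d' X"
  using X
proof (induction n arbitrary: X)
  case 0
  then show ?case using eq1 by simp
next
  case (Suc n)
  note X = Suc.prems
  have split: "X = {xs \<in> X. butlast xs \<in> fibre_dim_set e X 0} \<union> {xs \<in> X. butlast xs \<in> fibre_dim_set e X 1}"
    if e: "dimension_function DLO e" for e
  proof -
    have "butlast xs \<in> fibre_dim_set e X 0 \<or> butlast xs \<in> fibre_dim_set e X 1" if xs: "xs \<in> X" for xs
    proof -
      have len: "length xs = Suc (Suc n)" using definable_length[OF X xs] .
      then have "xs \<noteq> []" by auto
      with xs have "[last xs] \<in> fibre X (butlast xs)" by (simp add: fibre_def)
      moreover have "fibre X (butlast xs) \<in> definable_sets DLO 1"
        by (rule definable_fibre[OF X]) (simp add: len)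
      ultimately have "e (fibre X (butlast xs)) = Some 0 \<or> e (fibre X (butlast xs)) = Some 1"
        using dimension_1_cases[OF e] by blast
      with xs show ?thesis unfolding fibre_dim_set_def by blast
    qed
    then show ?thesis by blast
  qed
  have fds: "fibre_dim_set d X i = fibre_dim_set d' X i" for i
  proof -
    have "d (fibre X x) = d' (fibre X x)" if "x \<in> butlast ` X" for x
    proof (rule eq1, rule definable_fibre[OF X])
      show "length x = Suc n" using that definable_length[OF X] by auto
    qed
    then show ?thesis unfolding fibre_dim_set_def by auto
  qed
  have part: "d {xs \<in> X. butlast xs \<in> fibre_dim_set d X i} = d' {xs \<in> X. butlast xs \<in> fibre_dim_set d X i}"
    "{xs \<in> X. butlast xs \<in> fibre_dim_set d X i} \<in> definable_sets DLO (Suc (Suc n))"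
    if i: "i \<in> {0, 1}" for i
  proof -
    have B: "fibre_dim_set d X i \<in> definable_sets DLO (Suc n)"
      using dimension_functionD(6)[OF d(1) zero_less_Suc X i] .
    show "{xs \<in> X. butlast xs \<in> fibre_dim_set d X i} \<in> definable_sets DLO (Suc (Suc n))"
      using definable_restrict_butlast[OF X B] .
    show "d {xs \<in> X. butlast xs \<in> fibre_dim_set d X i} = d' {xs \<in> X. butlast xs \<in> fibre_dim_set d X i}"
      using dimension_functionD(7)[OF d(1) zero_less_Suc X i]
        dimension_functionD(7)[OF d(2) zero_less_Suc X i, folded fds] Suc.IH[OF B] by simp
  qed
  let ?P = "\<lambda>i. {xs \<in> X. butlast xs \<in> fibre_dim_set d X i}"
  have "d (?P 0 \<union> ?P 1) = d' (?P 0 \<union> ?P 1)"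
    using dimension_functionD(5)[OF d(1) zero_less_Suc part(2)[of 0] part(2)[of 1]]
      dimension_functionD(5)[OF d(2) zero_less_Suc part(2)[of 0] part(2)[of 1]]
      part(1)[of 0] part(1)[of 1] by simp
  with split[OF d(1)] show ?case by simp
qed

text \<open>Agreement on this code spreads from arity one to all arities; on sets that are not
  definable both functions are \<open>undefined\<close> by convention.\<close>

lemma inj_on_fibre_dim_set_gap_family:
  "inj_on (\<lambda>d. fibre_dim_set d gap_family 0)
    {d. dimension_function (DLO :: (unit, unit, 'a::unbounded_dense_linorder) fo_structure) d}"
proof (rule inj_onI)
  fix d d' :: "'a list set \<Rightarrow> nat option"
  assume "d \<in> {d. dimension_function DLO d}" "d' \<in> {d. dimension_function DLO d}"
    and eq: "fibre_dim_set d gap_family 0 = fibre_dim_set d' gap_family 0"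
  then have d: "dimension_function DLO d" "dimension_function DLO d'" by simp_all
  show "d = d'"
  proof
    fix X :: "'a list set"
    show "d X = d' X"
    proof (cases "X \<in> all_definable_sets (DLO :: (unit, unit, 'a) fo_structure)")
      case True
      then obtain n where n: "n > 0" "X \<in> definable_sets (DLO :: (unit, unit, 'a) fo_structure) n"
        unfolding all_definable_sets_def by auto
      then obtain m where "n = Suc m" by (cases n) auto
      with n(2) show ?thesis
        using dimension_eq_definable[OF d dimension_eq_definable_1[OF d eq]] by blast
    next
      case False
      then show ?thesis using d[THEN dimension_functionD(1)] by simp
    qed
  qed
qed

section \<open>Counting definable sets\<close>

instance fo_term :: (countable) countable by countable_datatype

instance formula :: (countable, countable) countable by countable_datatype

lemma card_of_lists_UNIV_ordLeq:
  assumes "infinite (UNIV :: 'a set)"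
  shows "|UNIV :: 'a list set| \<le>o |UNIV :: 'a set|"
proof -
  have len: "|{xs :: 'a list. length xs = n}| \<le>o |UNIV :: 'a set|" for n
  proof (induction n)
    case 0
    have "{xs :: 'a list. length xs = 0} = {[]}" by auto
    then show ?case using card_of_singl_ordLeq[of "UNIV :: 'a set"] by simp
  next
    case (Suc n)
    let ?L = "{xs :: 'a list. length xs = n}"
    have "{xs :: 'a list. length xs = Suc n} = (\<lambda>(x, xs). x # xs) ` (UNIV \<times> ?L)"
      by (auto simp: length_Suc_conv image_iff)
    then have "|{xs :: 'a list. length xs = Suc n}| \<le>o |(UNIV :: 'a set) \<times> ?L|"
      using card_of_image by metis
    moreover have "|(UNIV :: 'a set) \<times> ?L| \<le>o |UNIV :: 'a set|"
      by (rule card_of_Sigma_ordLeq_infinite[OF assms]) (use Suc in \<open>simp_all add: card_of_refl ordIso_imp_ordLeq\<close>)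
    ultimately show ?case using ordLeq_transitive by blast
  qed
  have "|UNIV :: nat set| \<le>o |UNIV :: 'a set|" using assms infinite_iff_card_of_nat by blast
  from card_of_UNION_ordLeq_infinite[OF assms this ballI[OF len]]
  have "|\<Union>n. {xs :: 'a list. length xs = n}| \<le>o |UNIV :: 'a set|" .
  moreover have "(\<Union>n. {xs :: 'a list. length xs = n}) = UNIV" by auto
  ultimately show ?thesis by simp
qed

text \<open>An environment assigns infinitely many parameters, and there can be more than
  \<open>|M|\<close> such sequences. Truth depends only on a finite set \<open>V\<close> of
  variables, so a formula and a finite list of parameters determine the set.\<close>

lemma card_of_definable_sets_ordLeq:
  "|definable_sets (DLO :: (unit, unit, 'a::unbounded_dense_linorder) fo_structure) n| \<le>o |UNIV :: 'a set|"
proof -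
  let ?M = "DLO :: (unit, unit, 'a) fo_structure"
  define S where "S = (\<lambda>(\<phi> :: (unit, unit) formula, as :: 'a list).
    {xs. length xs = n \<and> sat ?M (\<lambda>i. if i < n then xs ! i else as ! (i - n)) \<phi>})"
  have inf: "infinite (UNIV :: 'a set)"
    using infinite_Ioi[of "undefined :: 'a"] finite_subset[OF subset_UNIV] by blast
  have "definable_sets ?M n \<subseteq> range S"
  proof
    fix X assume "X \<in> definable_sets ?M n"
    then obtain \<phi> e where \<phi>: "wf_formula ?M \<phi>"
      and X: "X = {xs. length xs = n \<and> sat ?M (\<lambda>i. if i < n then xs ! i else e i) \<phi>}"
      unfolding definable_sets_def by blast
    obtain V where V: "finite V"
      "\<And>e e' :: nat \<Rightarrow> 'a. order_preserving ((\<lambda>i. (e i, e' i)) ` V) \<Longrightarrow> sat ?M e \<phi> \<longleftrightarrow> sat ?M e' \<phi>"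
      using sat_order_invariant[OF \<phi>] by metis
    obtain k where k: "\<forall>i\<in>V. i < k" using V(1) by (metis finite_nat_set_iff_bounded)
    \<comment> \<open>Entry \<open>i - n\<close> is the value of \<open>e\<close> at
      \<open>i\<close> for \<open>n \<le> i < k\<close>. As \<open>k\<close> lies above
      \<open>V\<close>, the unspecified values of \<open>nth\<close> past the end of the list do not
      affect the truth of \<open>\<phi>\<close>.\<close>
    define as where "as = map e [n..<k]"
    have "sat ?M (\<lambda>i. if i < n then xs ! i else e i) \<phi> \<longleftrightarrow>
        sat ?M (\<lambda>i. if i < n then xs ! i else as ! (i - n)) \<phi>" for xs
    proof (rule V(2))
      have "as ! (i - n) = e i" if "i \<in> V" "\<not> i < n" for i
        using that bspec[OF k that(1)] by (simp add: as_def diff_less_mono)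
      then show "order_preserving ((\<lambda>i. (if i < n then xs ! i else e i,
          if i < n then xs ! i else as ! (i - n))) ` V)"
        by (intro order_preserving_mono[OF order_preserving_Id[of UNIV]]) auto
    qed
    then have "X = S (\<phi>, as)" unfolding X S_def by simp
    then show "X \<in> range S" by blast
  qed
  then have "|definable_sets ?M n| \<le>o |range S|" by (rule card_of_mono1)
  also have "|range S| \<le>o |UNIV :: ((unit, unit) formula \<times> 'a list) set|" by (rule card_of_image)
  also have "|UNIV :: ((unit, unit) formula \<times> 'a list) set| \<le>o |UNIV :: 'a set|"
  proof -
    have "|UNIV :: (unit, unit) formula set| \<le>o |UNIV :: nat set|"
      using card_of_ordLeq[of "UNIV :: (unit, unit) formula set" "UNIV :: nat set"] inj_to_nat by blast
    also have "|UNIV :: nat set| \<le>o |UNIV :: 'a set|" using inf infinite_iff_card_of_nat by blast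
    finally have "|UNIV :: (unit, unit) formula set| \<le>o |UNIV :: 'a set|" .
    from card_of_Sigma_ordLeq_infinite[OF inf this ballI[OF card_of_lists_UNIV_ordLeq[OF inf]]]
    show ?thesis by simp
  qed
  finally show ?thesis .
qed

theorem proposition3p24:
  shows "n_dim (order_structure :: (unit, unit, 'a::unbounded_dense_linorder) fo_structure)
    =o |UNIV :: 'a set|"
proof -
  let ?M = "DLO :: (unit, unit, 'a) fo_structure"
  have "(\<lambda>d. fibre_dim_set d gap_family 0) ` {d. dimension_function ?M d} \<subseteq> definable_sets ?M 2"
  proof (rule image_subsetI)
    fix d :: "'a list set \<Rightarrow> nat option" assume "d \<in> {d. dimension_function ?M d}"
    then show "fibre_dim_set d gap_family 0 \<in> definable_sets ?M 2"
      using dimension_functionD(6)[of d 2 gap_family 0] definable_gap_family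
      by (simp add: numeral_3_eq_3 numeral_2_eq_2)
  qed
  with inj_on_fibre_dim_set_gap_family
  have "|{d. dimension_function ?M d}| \<le>o |definable_sets ?M 2|"
    using card_of_ordLeq[of "{d. dimension_function ?M d}" "definable_sets ?M 2"] by blast
  also have "|definable_sets ?M 2| \<le>o |UNIV :: 'a set|" by (rule card_of_definable_sets_ordLeq)
  finally have "|{d. dimension_function ?M d}| \<le>o |UNIV :: 'a set|" .
  moreover have "|UNIV :: 'a set| \<le>o |{d. dimension_function ?M d}|"
    using card_of_ordLeq[of "UNIV :: 'a set" "{d. dimension_function ?M d}"]
      inj_dim_above dimension_function_dim_above by blast
  ultimately show ?thesis unfolding n_dim_def by (simp add: ordIso_iff_ordLeq)
qed

end
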